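(* In the beeping model with adversarial wake-up and wake-on-beep (without sender-side collision detection), Algorithm 3 (described in the context) locally converges to an MIS in $O(\log^3 n)$ rounds, where $n$ is the number of nodes, which is unknown to the nodes.
   Context: A network is an undirected graph $G=(V,E)$ with $n=|V|$ anonymous nodes running the same randomized algorithm in synchronous rounds, with no knowledge of the network. Nodes are initially asleep; an adversary wakes nodes at arbitrary times and (wake-on-beep) a sleeping node also wakes up when a neighbor beeps. Beeping model: in each round a participating node either beeps or listens; a listening node learns only whether at least one neighbor beeped; a beeping node receives no feedback. $c$ is a sufficiently large constant. Algorithm 3: Upon waking up, a node beeps once, waits one round, and sets $x\leftarrow0$, $v\leftarrow0$, $z\leftarrow0$. Then it repeats forever: $x\leftarrow x+1$; for $i=0,\dots,x$: if $v=0$ and $z=0$ it sets $v\leftarrow1$ with probability $2^{-i}$; it picks a vector $X\in\{0,1\}^{cx}$ with independent uniform entries and then sets one uniformly random entry of $X$ to $1$; it sets $z\leftarrow0$; then it performs $cx$ competition exchanges $k=1,\dots,cx$, each of three rounds: in the first round it listens and if it hears a beep sets $v\leftarrow0,z\leftarrow1$; in the second round, if $v=0$ or $X[k]=0$ it listens and if it hears a beep sets $v\leftarrow0,z\leftarrow1$, and otherwise (if $v=1$ and $X[k]=1$) it beeps; in the third round it listens and if it hears a beep sets $v\leftarrow0$. A node with $v=1$ is in the MIS state (it keeps $v=1$ and continues beeping in the selected exchanges of all future steps unless it hears a beep); a node with $v=0$ is inactive, and a node that heard a beep in the competition exchanges ($z=1$) does not try to set $v\leftarrow1$ until it completes a full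 set of competition exchanges without hearing a beep. An algorithm locally converges to an MIS in $T$ rounds if every node, with high probability (probability at least $1-n^{-c'}$ for any constant $c'\ge1$), irrevocably decides within $T$ rounds, regardless of other wake-ups, whether it is in the MIS state, and the MIS-state nodes form a maximal independent set.
   Formalization: In the third round of each exchange, a node that hears a beep sets z←1 as well as v←0, as the sentence on z=1 demands; with v←0 alone the claim fails on a long path woken from one end. *)

theory Defs
  imports "HOL-Probability.Probability" "HOL-Library.Landau_Symbols"
begin

section \<open>Networks and maximal independent sets\<close>

definition network :: "'v set \<Rightarrow> ('v \<times> 'v) set \<Rightarrow> bool" where
  "network V E \<longleftrightarrow> finite V \<and> E \<subseteq> V \<times> V \<and> sym E \<and> irrefl E"

definition independent_set :: "'v set \<Rightarrow> ('v \<times> 'v) set \<Rightarrow> 'v set \<Rightarrow> bool" where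
  "independent_set V E S \<longleftrightarrow> S \<subseteq> V \<and> (\<forall>u\<in>S. \<forall>w\<in>S. (u, w) \<notin> E)"

definition maximal_independent_set :: "'v set \<Rightarrow> ('v \<times> 'v) set \<Rightarrow> 'v set \<Rightarrow> bool" where
  "maximal_independent_set V E S \<longleftrightarrow>
     independent_set V E S \<and> (\<forall>S'. independent_set V E S' \<and> S \<subseteq> S' \<longrightarrow> S' = S)"

section \<open>The beeping model with wake-on-beep\<close>

text \<open>
  An anonymous algorithm: every node runs the same state machine, on a private random tape drawn
  from the distribution \<open>coins\<close>. In each round a node beeps if \<open>beeps\<close> holds of its state and
  listens otherwise; \<open>update r h s\<close> is its state at the start of the next round, where \<open>r\<close> is its
  tape and \<open>h\<close> says whether it heard a beep.
\<close>

record ('s, 'r) beeping_algorithm =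
  initial :: 's
  beeps :: "'s \<Rightarrow> bool"
  update :: "'r \<Rightarrow> bool \<Rightarrow> 's \<Rightarrow> 's"
  in_mis :: "'s \<Rightarrow> bool"
  coins :: "'r measure"

text \<open>In a configuration, \<open>None\<close> is a sleeping node.\<close>

type_synonym ('v, 's) config = "'v \<Rightarrow> 's option"

definition beeping :: "('s, 'r) beeping_algorithm \<Rightarrow> ('v, 's) config \<Rightarrow> 'v \<Rightarrow> bool" where
  "beeping A C u \<longleftrightarrow> (\<exists>s. C u = Some s \<and> beeps A s)"

definition neighbor_beeps ::
  "('s, 'r) beeping_algorithm \<Rightarrow> ('v \<times> 'v) set \<Rightarrow> ('v, 's) config \<Rightarrow> 'v \<Rightarrow> bool" where
  "neighbor_beeps A E C u \<longleftrightarrow> (\<exists>w. (u, w) \<in> E \<and> beeping A C w)"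

text \<open>
  \<open>W t\<close> is the set of nodes that the adversary wakes in round \<open>t\<close>; these take part from round \<open>t\<close>
  on. A sleeping node with a neighbour that beeps in round \<open>t\<close> takes part from round \<open>t + 1\<close> on.
  A beeping node gets no feedback: its \<open>update\<close> is always told that nothing was heard.
\<close>

primrec execution ::
  "('s, 'r) beeping_algorithm \<Rightarrow> 'v set \<Rightarrow> ('v \<times> 'v) set \<Rightarrow> (nat \<Rightarrow> 'v set) \<Rightarrow> ('v \<Rightarrow> 'r) \<Rightarrow>
   nat \<Rightarrow> ('v, 's) config" where
  "execution A V E W \<omega> 0 = (\<lambda>u. if u \<in> V \<and> u \<in> W 0 then Some (initial A) else None)"
| "execution A V E W \<omega> (Suc t) =
     (let C = execution A V E W \<omega> t in
      (\<lambda>u. case C u of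
             Some s \<Rightarrow> Some (update A (\<omega> u) (\<not> beeps A s \<and> neighbor_beeps A E C u) s)
           | None \<Rightarrow>
               if u \<in> V \<and> (u \<in> W (Suc t) \<or> neighbor_beeps A E C u)
               then Some (initial A) else None))"

definition tapes :: "('s, 'r) beeping_algorithm \<Rightarrow> 'v set \<Rightarrow> ('v \<Rightarrow> 'r) measure" where
  "tapes A V = (\<Pi>\<^sub>M u\<in>V. coins A)"

section \<open>Local convergence to a maximal independent set\<close>

definition wakes_at :: "(nat \<Rightarrow> ('v, 's) config) \<Rightarrow> 'v \<Rightarrow> nat \<Rightarrow> bool" where
  "wakes_at R u s \<longleftrightarrow> R s u \<noteq> None \<and> (\<forall>t<s. R t u = None)"

definition mis_state :: "('s, 'r) beeping_algorithm \<Rightarrow> ('v, 's) config \<Rightarrow> 'v \<Rightarrow> bool" where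
  "mis_state A C u \<longleftrightarrow> (\<exists>s. C u = Some s \<and> in_mis A s)"

definition decides_mis ::
  "('s, 'r) beeping_algorithm \<Rightarrow> (nat \<Rightarrow> ('v, 's) config) \<Rightarrow> nat \<Rightarrow> 'v \<Rightarrow> bool" where
  "decides_mis A R T u \<longleftrightarrow> (\<exists>s. wakes_at R u s \<and> (\<forall>t\<ge>s + T. mis_state A (R t) u))"

definition decides_inactive ::
  "('s, 'r) beeping_algorithm \<Rightarrow> (nat \<Rightarrow> ('v, 's) config) \<Rightarrow> nat \<Rightarrow> 'v \<Rightarrow> bool" where
  "decides_inactive A R T u \<longleftrightarrow> (\<exists>s. wakes_at R u s \<and> (\<forall>t\<ge>s + T. \<not> mis_state A (R t) u))"

definition ever_awake :: "'v set \<Rightarrow> (nat \<Rightarrow> ('v, 's) config) \<Rightarrow> 'v set" where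
  "ever_awake V R = {u \<in> V. \<exists>t. R t u \<noteq> None}"

text \<open>
  Against every wake-up schedule, with error probability at most \<open>n\<^sup>-\<^sup>c\<^sup>'\<close>: each node that is woken
  irrevocably decides within \<open>T\<close> rounds of its own wake-up, and the nodes that have so decided to be
  in the MIS state form a maximal independent set. Nodes that are never woken (their whole connected
  component sleeps forever) do not take part.
\<close>

definition locally_converges_to_mis ::
  "('s, 'r) beeping_algorithm \<Rightarrow> real \<Rightarrow> 'v set \<Rightarrow> ('v \<times> 'v) set \<Rightarrow> nat \<Rightarrow> bool" where
  "locally_converges_to_mis A c' V E T \<longleftrightarrow>
     (\<forall>W.
        (\<forall>u\<in>V. \<P>(\<omega> in tapes A V.
              let R = execution A V E W \<omega> in
              u \<in> ever_awake V R \<longrightarrow> decides_mis A R T u \<or> decides_inactive A R T u)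
            \<ge> 1 - real (card V) powr (- c')) \<and>
        \<P>(\<omega> in tapes A V.
              let R = execution A V E W \<omega> in
              maximal_independent_set (ever_awake V R) E {u \<in> V. decides_mis A R T u})
            \<ge> 1 - real (card V) powr (- c'))"

section \<open>The algorithm\<close>

text \<open>
  The phase of a node is the kind of round it is about to execute: its wake-up beep, the round it
  waits, or one of the three rounds of a competition exchange. \<open>estimate\<close>, \<open>index\<close>, \<open>exchange\<close> are
  the loop variables \<open>x\<close>, \<open>i\<close>, \<open>k\<close>, with \<open>k\<close> counted from \<open>0\<close>; \<open>v_flag\<close>, \<open>z_flag\<close>, \<open>competition\<close>
  are \<open>v\<close>, \<open>z\<close>, \<open>X\<close>.
\<close>

datatype phase = Wake_Beep | Wait | Round1 | Round2 | Round3

record node_state =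
  phase :: phase
  estimate :: nat
  index :: nat
  exchange :: nat
  v_flag :: bool
  z_flag :: bool
  competition :: "bool list"

text \<open>
  The random choices of step \<open>(x, i)\<close>: the coin with bias \<open>2\<^sup>-\<^sup>i\<close> (drawn in every step, but used only
  if \<open>v = z = 0\<close>) and the vector \<open>X\<close>. A tape supplies independent choices for all steps.
\<close>

definition step_choice :: "nat \<Rightarrow> nat \<Rightarrow> nat \<Rightarrow> (bool \<times> bool list) pmf" where
  "step_choice c x i =
     do {
       b \<leftarrow> bernoulli_pmf (1 / 2 ^ i);
       Y \<leftarrow> pmf_of_set {Y. length Y = c * x};
       j \<leftarrow> pmf_of_set {..<c * x};
       return_pmf (b, Y[j := True])
     }"

type_synonym tape = "nat \<times> nat \<Rightarrow> bool \<times> bool list"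

definition tape_distribution :: "nat \<Rightarrow> tape measure" where
  "tape_distribution c = (\<Pi>\<^sub>M (x, i)\<in>UNIV. measure_pmf (step_choice c x i))"

definition start_step :: "tape \<Rightarrow> nat \<Rightarrow> nat \<Rightarrow> node_state \<Rightarrow> node_state" where
  "start_step r x i s =
     s\<lparr> phase := Round1, estimate := x, index := i, exchange := 0,
        v_flag := v_flag s \<or> (\<not> z_flag s \<and> fst (r (x, i))),
        z_flag := False,
        competition := snd (r (x, i)) \<rparr>"

definition finish_exchange :: "nat \<Rightarrow> tape \<Rightarrow> node_state \<Rightarrow> node_state" where
  "finish_exchange c r s =
     (if exchange s + 1 < c * estimate s then s\<lparr> phase := Round1, exchange := exchange s + 1 \<rparr>
      else if index s < estimate s then start_step r (estimate s) (index s + 1) s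
      else start_step r (estimate s + 1) 0 s)"

definition react :: "bool \<Rightarrow> node_state \<Rightarrow> node_state" where
  "react h s = (if h then s\<lparr> v_flag := False, z_flag := True \<rparr> else s)"

definition alg3_initial :: node_state where
  "alg3_initial =
     \<lparr> phase = Wake_Beep, estimate = 0, index = 0, exchange = 0,
       v_flag = False, z_flag = False, competition = [] \<rparr>"

definition alg3_beeps :: "node_state \<Rightarrow> bool" where
  "alg3_beeps s \<longleftrightarrow>
     phase s = Wake_Beep \<or> phase s = Round2 \<and> v_flag s \<and> competition s ! exchange s"

text \<open>
  A beep heard in any of the three rounds sets \<open>z\<close>, so that \<open>z = 1\<close> means that the node heard a beep
  during its last set of competition exchanges. This has to include the third round, which is where
  a node hears a neighbour that woke up one round later: if such beeps only reset \<open>v\<close>, an inactive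
  node would keep competing against, and displace, a neighbour in the MIS that woke up after it.
\<close>

definition alg3_update :: "nat \<Rightarrow> tape \<Rightarrow> bool \<Rightarrow> node_state \<Rightarrow> node_state" where
  "alg3_update c r h s =
     (case phase s of
        Wake_Beep \<Rightarrow> s\<lparr> phase := Wait \<rparr>
      | Wait \<Rightarrow> start_step r 1 0 s
      | Round1 \<Rightarrow> (react h s)\<lparr> phase := Round2 \<rparr>
      | Round2 \<Rightarrow> (react h s)\<lparr> phase := Round3 \<rparr>
      | Round3 \<Rightarrow> finish_exchange c r (react h s))"

definition algorithm3 :: "nat \<Rightarrow> (node_state, tape) beeping_algorithm" where
  "algorithm3 c =
     \<lparr> initial = alg3_initial, beeps = alg3_beeps, update = alg3_update c,
       in_mis = v_flag, coins = tape_distribution c \<rparr>"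

end

theory Submission
  imports Defs
begin

text \<open>
  A waking node beeps, so neighbours wake up at most one round apart and stay aligned up to one round
  for ever; the three rounds of an exchange absorb this skew. A node with \<open>v = 1\<close> all of whose
  neighbours have \<open>v = 0\<close> and \<open>z = 1\<close> at the end of a step keeps this property for ever: its neighbours
  may not try to join in the next step and hear it again. Call such a node locked. If adjacent nodes
  have distinct vectors \<open>X\<close> in a step, then every node with \<open>v = 1\<close> after this step is locked, and
  once \<open>x\<close> is of order \<open>log n\<close> this holds in all later steps with high probability.

  Consider the graph of the undecided nodes, those neither locked nor adjacent to a locked node. At the
  steps \<open>i - 1\<close> and \<open>i\<close> of a loop, where \<open>2\<^sup>i\<close> is about the degree \<open>d\<close> of \<open>u\<close>, each neighbour of degree
  at most \<open>d\<close> joins with probability of order \<open>1 / d\<close>, and then all \<open>d\<close> edges at \<open>u\<close> disappear.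
  Charging each edge to its endpoint of larger degree, a loop over \<open>i\<close> removes in expectation a
  constant fraction of the edges. After \<open>O(log n)\<close> loops, of \<open>O(log\<^sup>2 n)\<close> rounds each, no edge is left, and
  the isolated nodes join in the next two loops.
\<close>

section \<open>Competition steps\<close>

text \<open>Wake-up times of distant nodes may differ arbitrarily, so steps are numbered by each
  node's own clock: \<open>flags_at h j\<close> combines flags that the nodes have in different
  rounds. This is sound because a node interacts only with neighbours, whose clocks are at most one
  round off, and it yields a synchronous process on flags. Irrevocability over infinitely many later
  steps costs no probability: a lock persists under \<open>proper\<close> choices, which are almost
  sure, while \<open>distinguishing\<close> choices are demanded in finitely many steps only.
  Progress is measured by expectation operators that discard runs with a bad step, so that
  \<open>all_locked\<close> becomes a deterministic invariant; the discarded mass is paid for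
  separately by a union bound. The factor 1 - 1/4096 per loop stems from a probability of at least
  1/(1024 d) that a given neighbour of degree at most d joins, a factor 2 for neighbours decided
  earlier in the loop, and a factor 2 for charging edges to one endpoint. The constant
  \<open>c\<close> need only be at least 2: a larger exponent \<open>c'\<close> is bought by
  starting the analysis at a later loop.\<close>

text \<open>The flags of a node are its pair \<open>(v, z)\<close>.\<close>

type_synonym 'v flags = "'v \<Rightarrow> bool \<times> bool"
type_synonym 'v choices = "'v \<Rightarrow> bool \<times> bool list"

definition heed :: "bool \<Rightarrow> bool \<times> bool \<Rightarrow> bool \<times> bool" where
  "heed h f = (if h then (False, True) else f)"

locale synced_network =
  fixes U :: "'v set" and E :: "('v \<times> 'v) set" and wake :: "'v \<Rightarrow> nat"
  assumes finite_U: "finite U"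
    and edges: "E \<subseteq> U \<times> U"
    and sym_E: "sym E"
    and irrefl_E: "irrefl E"
    and wake_le: "(u, w) \<in> E \<Longrightarrow> wake w \<le> Suc (wake u)"
begin

lemma edge_sym: "(u, w) \<in> E \<Longrightarrow> (w, u) \<in> E"
  using sym_E by (auto dest: symD)

lemma wake_cases:
  assumes "(u, w) \<in> E"
  obtains "wake w = wake u" | "wake w = Suc (wake u)" | "wake u = Suc (wake w)"
  using wake_le[OF assms] wake_le[OF edge_sym[OF assms]] by linarith

section \<open>Beeping and hearing within one exchange\<close>

text \<open>
  Within one exchange a node hears its earlier-waking neighbours before its own beep, so the set of
  beeping nodes among the candidates \<open>a\<close> is determined layer by layer in the order of the wake-up
  times.
\<close>

primrec beep_layer :: "('v \<Rightarrow> bool) \<Rightarrow> nat \<Rightarrow> 'v set" where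
  "beep_layer a 0 = {u. wake u = 0 \<and> a u}"
| "beep_layer a (Suc m) =
     {u. wake u = Suc m \<and> a u \<and> (\<forall>w. (u, w) \<in> E \<longrightarrow> w \<notin> beep_layer a m)}"

definition beeper :: "('v \<Rightarrow> bool) \<Rightarrow> 'v \<Rightarrow> bool" where
  "beeper a u \<longleftrightarrow> u \<in> beep_layer a (wake u)"

text \<open>The digit is the listener's own round: a neighbour beeps in its own second round, which
  is the listener's first, second or third round if the neighbour woke one round earlier,
  simultaneously or one round later.\<close>

definition hears1 :: "('v \<Rightarrow> bool) \<Rightarrow> 'v \<Rightarrow> bool" where
  "hears1 a u \<longleftrightarrow> (\<exists>w. (u, w) \<in> E \<and> wake u = Suc (wake w) \<and> beeper a w)"

definition hears2 :: "('v \<Rightarrow> bool) \<Rightarrow> 'v \<Rightarrow> bool" where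
  "hears2 a u \<longleftrightarrow> \<not> beeper a u \<and> (\<exists>w. (u, w) \<in> E \<and> wake w = wake u \<and> beeper a w)"

definition hears3 :: "('v \<Rightarrow> bool) \<Rightarrow> 'v \<Rightarrow> bool" where
  "hears3 a u \<longleftrightarrow> (\<exists>w. (u, w) \<in> E \<and> wake w = Suc (wake u) \<and> beeper a w)"

definition hears :: "('v \<Rightarrow> bool) \<Rightarrow> 'v \<Rightarrow> bool" where
  "hears a u \<longleftrightarrow> hears1 a u \<or> hears2 a u \<or> hears3 a u"

lemma beep_layer_wake: "u \<in> beep_layer a m \<Longrightarrow> wake u = m"
  by (cases m) auto

lemma beeper_iff: "beeper a u \<longleftrightarrow> a u \<and> \<not> hears1 a u"
proof (cases "wake u")
  case 0
  then show ?thesis by (simp add: beeper_def hears1_def)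
next
  case (Suc m)
  then show ?thesis
    by (auto simp: beeper_def hears1_def dest: beep_layer_wake)
qed

lemma hears_imp_beeper: "hears a u \<Longrightarrow> \<exists>w. (u, w) \<in> E \<and> beeper a w"
  by (auto simp: hears_def hears1_def hears2_def hears3_def)

text \<open>A skew of at most one round puts the neighbour's beep into one of the three rounds of
  \<open>u\<close>; the only deaf round is the second round of a beeping node.\<close>

lemma beeper_imp_hears:
  assumes "(u, w) \<in> E" "beeper a w" "\<not> beeper a u"
  shows "hears a u"
  using assms(1)
  by (cases rule: wake_cases)
    (use assms in \<open>auto simp: hears_def hears1_def hears2_def hears3_def\<close>)

section \<open>One step as a sequence of exchanges\<close>

definition start_flags :: "'v flags \<Rightarrow> 'v choices \<Rightarrow> 'v flags" where
  "start_flags f r = (\<lambda>u. (fst (f u) \<or> \<not> snd (f u) \<and> fst (r u), False))"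

definition candidate :: "'v flags \<Rightarrow> 'v choices \<Rightarrow> nat \<Rightarrow> 'v \<Rightarrow> bool" where
  "candidate g r k u \<longleftrightarrow> fst (g u) \<and> snd (r u) ! k"

primrec exchanges :: "'v flags \<Rightarrow> 'v choices \<Rightarrow> nat \<Rightarrow> 'v flags" where
  "exchanges f r 0 = start_flags f r"
| "exchanges f r (Suc k) =
     (let g = exchanges f r k in (\<lambda>u. heed (hears (candidate g r k) u) (g u)))"

lemma exchanges_monotone:
  assumes "k \<le> l"
  shows "fst (exchanges f r l u) \<Longrightarrow> fst (exchanges f r k u)"
    and "snd (exchanges f r k u) \<Longrightarrow> snd (exchanges f r l u)"
  using assms by (induction rule: dec_induct) (auto simp: heed_def Let_def split: if_splits)

lemma exchanges_not_both: "\<not> (fst (exchanges f r l u) \<and> snd (exchanges f r l u))"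
  by (induction l) (auto simp: heed_def Let_def start_flags_def)

text \<open>A step starts with \<open>z = 0\<close> and only hearing sets \<open>z\<close>, so
  \<open>z = 0\<close> at the end certifies silence throughout, and silence leaves the flags
  unchanged.\<close>

lemma exchanges_undisturbed:
  assumes "\<not> snd (exchanges f r l u)"
  shows "exchanges f r l u = start_flags f r u"
    and "k < l \<Longrightarrow> \<not> hears (candidate (exchanges f r k) r k) u"
  using assms
proof (induction l)
  case (Suc l)
  {
    case 1
    then show ?case using Suc by (auto simp: heed_def Let_def split: if_splits)
  next
    case 2
    then show ?case using Suc by (auto simp: heed_def Let_def less_Suc_eq split: if_splits)
  }
qed auto

lemma exchanges_hearD:
  assumes "snd (exchanges f r l u)"
  shows "\<exists>w. (u, w) \<in> E \<and> fst (start_flags f r w)"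
  using assms
proof (induction l)
  case (Suc l)
  show ?case
  proof (cases "snd (exchanges f r l u)")
    case False
    then have "hears (candidate (exchanges f r l) r l) u"
      using Suc.prems by (auto simp: heed_def Let_def split: if_splits)
    then obtain w where "(u, w) \<in> E" "fst (exchanges f r l w)"
      by (auto dest!: hears_imp_beeper simp: beeper_iff candidate_def)
    then show ?thesis
      using exchanges_monotone(1)[of 0 l f r w] by auto
  qed (use Suc in auto)
qed (auto simp: start_flags_def)

text \<open>If \<open>w\<close> heard nothing either, both nodes would keep their initial flags, so
  their beeps would be exactly the 1-entries of their vectors (none at all if \<open>w\<close>
  starts with \<open>v = 0\<close>). A beep of only one of them is heard by the other, so the two
  beep patterns coincide, contradicting \<open>diff\<close>.\<close>

lemma exchanges_silence:
  assumes u: "fst (exchanges f r l u)" and edge: "(u, w) \<in> E"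
    and len: "length (snd (r u)) = l" "length (snd (r w)) = l"
    and X: "k < l" "snd (r u) ! k"
    and diff: "\<not> fst (start_flags f r w) \<or> snd (r u) \<noteq> snd (r w)"
  shows "snd (exchanges f r l w)"
proof (rule ccontr)
  assume w: "\<not> snd (exchanges f r l w)"
  have nz: "\<not> snd (exchanges f r l u)"
    using u exchanges_not_both by blast
  define B where "B i = beeper (candidate (exchanges f r i) r i)" for i
  have alive: "exchanges f r i x = start_flags f r x"
    if "\<not> snd (exchanges f r l x)" "i < l" for i x
    using that exchanges_monotone(2)[of i l f r x] exchanges_undisturbed(1)[of f r i x] by fastforce
  have Bx: "B i x \<longleftrightarrow> fst (start_flags f r x) \<and> snd (r x) ! i"
    if "\<not> snd (exchanges f r l x)" "i < l" for i x
    using alive[OF that] exchanges_undisturbed(2)[OF that]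
    by (auto simp: B_def beeper_iff candidate_def hears_def)
  have same: "B i u \<longleftrightarrow> B i w" if "i < l" for i
    using beeper_imp_hears[OF edge] beeper_imp_hears[OF edge_sym[OF edge]]
      exchanges_undisturbed(2)[OF w that] exchanges_undisturbed(2)[OF nz that]
    by (auto simp: B_def)
  have su: "fst (start_flags f r u)"
    using u exchanges_undisturbed(1)[OF nz] by simp
  show False
  proof (cases "fst (start_flags f r w)")
    case False
    then show False using same[OF X(1)] Bx[OF w X(1)] Bx[OF nz X(1)] X su by simp
  next
    case True
    then have "snd (r u) \<noteq> snd (r w)" using diff by simp
    then obtain i where "i < l" "snd (r u) ! i \<noteq> snd (r w) ! i"
      using len nth_equalityI[of "snd (r u)" "snd (r w)"] by auto
    then show False using same[of i] Bx[OF w] Bx[OF nz] su True by auto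
  qed
qed

text \<open>This property is almost sure in all steps at once, whereas \<open>distinguishing\<close>
  can fail. Keeping them apart lets the persistence of locks rest on \<open>proper\<close>
  alone.\<close>

definition proper :: "nat \<Rightarrow> 'v choices \<Rightarrow> bool" where
  "proper l r \<longleftrightarrow> (\<forall>u\<in>U. length (snd (r u)) = l \<and> (\<exists>k<l. snd (r u) ! k))"

definition distinguishing :: "'v choices \<Rightarrow> bool" where
  "distinguishing r \<longleftrightarrow> (\<forall>(u, w)\<in>E. snd (r u) \<noteq> snd (r w))"

lemma exchanges_silence':
  assumes "proper l r" "fst (exchanges f r l u)" "(u, w) \<in> E"
    and "\<not> fst (start_flags f r w) \<or> distinguishing r"
  shows "snd (exchanges f r l w)" "\<not> fst (exchanges f r l w)"
proof -
  have uw: "u \<in> U" "w \<in> U" using assms(3) edges by auto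
  then obtain k where "k < l" "snd (r u) ! k"
    using assms(1) by (auto simp: proper_def)
  with uw show "snd (exchanges f r l w)"
    by (intro exchanges_silence[OF assms(2,3)])
      (use assms in \<open>auto simp: proper_def distinguishing_def\<close>)
  then show "\<not> fst (exchanges f r l w)"
    using exchanges_not_both by blast
qed

lemma exchanges_survive:
  assumes "fst (start_flags f r u)" "\<And>w. (u, w) \<in> E \<Longrightarrow> \<not> fst (start_flags f r w)"
  shows "fst (exchanges f r l u)"
  using exchanges_hearD[of f r l u] exchanges_undisturbed(1)[of f r l u] assms by fastforce

section \<open>Locked and undecided nodes\<close>

definition locked :: "'v flags \<Rightarrow> 'v \<Rightarrow> bool" where
  "locked f u \<longleftrightarrow> fst (f u) \<and> (\<forall>w. (u, w) \<in> E \<longrightarrow> \<not> fst (f w) \<and> snd (f w))"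

definition all_locked :: "'v flags \<Rightarrow> bool" where
  "all_locked f \<longleftrightarrow> (\<forall>u\<in>U. fst (f u) \<longrightarrow> locked f u)"

text \<open>Formulated with \<open>v\<close> only; under \<open>all_locked\<close> it means being
  neither locked nor adjacent to a locked node.\<close>

definition undecided :: "'v flags \<Rightarrow> 'v \<Rightarrow> bool" where
  "undecided f u \<longleftrightarrow> u \<in> U \<and> \<not> fst (f u) \<and> (\<forall>w. (u, w) \<in> E \<longrightarrow> \<not> fst (f w))"

lemma locked_start:
  assumes "locked f u"
  shows "fst (start_flags f r u)" "(u, w) \<in> E \<Longrightarrow> \<not> fst (start_flags f r w)"
  using assms by (auto simp: locked_def start_flags_def)

text \<open>Covers every prefix of a step, since the MIS state has to stay constant in all rounds
  and not just between steps.\<close>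

lemma locked_exchanges:
  assumes "locked f u"
  shows "fst (exchanges f r k u)" "(u, w) \<in> E \<Longrightarrow> \<not> fst (exchanges f r k w)"
  using exchanges_survive[of f r u k] locked_start[OF assms] exchanges_monotone(1)[of 0 k f r w]
  by auto

text \<open>The neighbours begin the step without \<open>v\<close>, so one beep of \<open>u\<close>
  suffices to renew their \<open>z\<close>; \<open>proper\<close> supplies the 1-entry for
  it.\<close>

lemma locked_persists:
  assumes "locked f u" "proper l r"
  shows "locked (exchanges f r l) u"
  using exchanges_silence'[OF assms(2) locked_exchanges(1)] locked_start[OF assms(1)] assms(1)
  by (auto simp: locked_def locked_exchanges)

text \<open>The flags \<open>f\<close> are arbitrary: a single step with such choices repairs any
  configuration, so the analysis can start at any step.\<close>

lemma all_locked_exchanges: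
  assumes "proper l r" "distinguishing r"
  shows "all_locked (exchanges f r l)"
  using exchanges_silence'[OF assms(1)] assms(2) by (auto simp: all_locked_def locked_def)

text \<open>Under \<open>all_locked\<close> a node with \<open>v = 1\<close> is locked and keeps
  \<open>v\<close>, so neither it nor a neighbour becomes undecided again.\<close>

lemma undecided_antimono:
  assumes "all_locked f" "proper l r" "undecided (exchanges f r l) u"
  shows "undecided f u"
  using assms edges locked_exchanges(1)[of f _ r l]
  by (auto simp: undecided_def all_locked_def)

text \<open>If \<open>y\<close> is not undecided then, having \<open>v = 0\<close> itself, it has a
  neighbour with \<open>v = 1\<close>; that one is locked, so \<open>y\<close> carries
  \<open>z = 1\<close> and may not try. Hence only undecided neighbours can disturb
  \<open>w\<close>.\<close>

lemma quiet_neighbor: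
  assumes "all_locked f" "undecided f w" "(w, y) \<in> E"
    and "undecided f y \<Longrightarrow> \<not> fst (r y)"
  shows "\<not> fst (start_flags f r y)"
proof (cases "undecided f y")
  case True
  then show ?thesis using assms(4) by (auto simp: start_flags_def undecided_def)
next
  case False
  have "\<not> fst (f y)" using assms by (auto simp: undecided_def)
  with False obtain x where "(y, x) \<in> E" "fst (f x)"
    using assms(3) edges by (auto simp: undecided_def)
  then have "snd (f y)"
    using assms(1) edges edge_sym[of y x] by (auto simp: all_locked_def locked_def)
  then show ?thesis using \<open>\<not> fst (f y)\<close> by (simp add: start_flags_def)
qed

lemma undisturbed_step:
  assumes "all_locked f" "undecided f w"
    and "\<And>y. (w, y) \<in> E \<Longrightarrow> undecided f y \<Longrightarrow> \<not> fst (r y)"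
  shows "\<not> snd (exchanges f r l w)"
  using exchanges_hearD[of f r l w] quiet_neighbor[OF assms(1,2)] assms(3) by blast

text \<open>The first of the two steps serves to clear the flag \<open>z\<close> of \<open>w\<close>.\<close>

lemma lone_candidate_joins:
  assumes ok: "all_locked f" and w: "undecided f w"
    and r1: "proper l1 r1" "distinguishing r1"
    and r2: "proper l2 r2"
    and q1: "\<And>y. (w, y) \<in> E \<Longrightarrow> undecided f y \<Longrightarrow> \<not> fst (r1 y)"
    and q2: "\<And>y. (w, y) \<in> E \<Longrightarrow> undecided f y \<Longrightarrow> \<not> fst (r2 y)"
    and coin: "fst (r2 w)"
  shows "fst (exchanges (exchanges f r1 l1) r2 l2 w)"
proof -
  define g where "g = exchanges f r1 l1"
  have ok': "all_locked g"
    unfolding g_def by (rule all_locked_exchanges[OF r1])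
  show ?thesis
  proof (cases "fst (g w)")
    case True
    then have "locked g w" using ok' w by (auto simp: all_locked_def undecided_def)
    then show ?thesis using locked_exchanges(1) by (simp add: g_def)
  next
    case False
    have nh: "\<not> snd (g w)"
      unfolding g_def by (rule undisturbed_step[OF ok w q1])
    have "undecided g w"
      unfolding undecided_def
    proof (intro conjI allI impI notI)
      \<comment> \<open>A neighbour that joined in the first step would be locked and would have
        left \<open>w\<close> with \<open>z = 1\<close>.\<close>
      fix y assume "(w, y) \<in> E" "fst (g y)"
      then have "locked g y" "(y, w) \<in> E" using ok' edges edge_sym by (auto simp: all_locked_def)
      then show False using nh by (auto simp: locked_def)
    qed (use w False in \<open>auto simp: undecided_def\<close>)
    then have "\<not> fst (start_flags g r2 y)" if "(w, y) \<in> E" for y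
      using quiet_neighbor[OF ok' _ that, of r2] q2[OF that]
        undecided_antimono[OF ok r1(1), of y] by (auto simp: g_def)
    moreover have "fst (start_flags g r2 w)"
      using nh coin by (simp add: start_flags_def)
    ultimately show ?thesis using exchanges_survive by (simp add: g_def)
  qed
qed

section \<open>The graph of undecided nodes\<close>

definition undecided_nbrs :: "'v flags \<Rightarrow> 'v \<Rightarrow> 'v set" where
  "undecided_nbrs f u = {w. (u, w) \<in> E \<and> undecided f w}"

text \<open>Zero at decided nodes, so that the sum over \<open>U\<close> is twice the number of
  edges of the undecided graph.\<close>

definition degree :: "'v flags \<Rightarrow> 'v \<Rightarrow> nat" where
  "degree f u = (if undecided f u then card (undecided_nbrs f u) else 0)"

lemma finite_undecided_nbrs [simp]: "finite (undecided_nbrs f u)"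
  by (rule finite_subset[OF _ finite_U]) (use edges in \<open>auto simp: undecided_nbrs_def\<close>)

lemma undecided_nbrs_subset: "undecided_nbrs f u \<subseteq> U"
  using edges by (auto simp: undecided_nbrs_def)

lemma degree_antimono:
  assumes "all_locked f" "proper l r"
  shows "degree (exchanges f r l) u \<le> degree f u"
  using undecided_antimono[OF assms] by (auto simp: degree_def undecided_nbrs_def intro!: card_mono
      intro: finite_subset[OF _ finite_undecided_nbrs, unfolded undecided_nbrs_def])

definition isolated :: "'v flags \<Rightarrow> bool" where
  "isolated f \<longleftrightarrow> (\<forall>u\<in>U. degree f u = 0)"

lemma isolatedD:
  assumes "isolated f" "undecided f u" "(u, w) \<in> E"
  shows "\<not> undecided f w"
proof
  assume "undecided f w"
  then have "w \<in> undecided_nbrs f u" using assms(3) by (simp add: undecided_nbrs_def)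
  moreover have "card (undecided_nbrs f u) = 0"
    using assms(1,2) by (auto simp: isolated_def degree_def undecided_def)
  ultimately show False by auto
qed

lemma isolated_exchanges:
  assumes "isolated f" "all_locked f" "proper l r"
  shows "isolated (exchanges f r l)"
  using degree_antimono[OF assms(2,3)] assms(1) by (auto simp: isolated_def) (metis le_zero_eq)

lemma isolated_free:
  assumes "isolated f" "all_locked f" "proper l r" "undecided (exchanges f r l) u"
  shows "\<not> snd (exchanges f r l u)"
  using undisturbed_step[OF assms(2) undecided_antimono[OF assms(2,3,4)]]
    isolatedD[OF assms(1) undecided_antimono[OF assms(2,3,4)]] by blast

text \<open>All undecided nodes become candidates, no two of them are adjacent, and their decided
  neighbours are held back by \<open>z\<close>; no symmetry has to be broken.\<close>

lemma isolated_joins: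
  assumes "isolated f" "all_locked f" "proper l r" "\<And>u. undecided f u \<Longrightarrow> \<not> snd (f u)"
    and coin: "\<And>u. u \<in> U \<Longrightarrow> fst (r u)"
  shows "\<not> undecided (exchanges f r l) u"
proof
  assume u: "undecided (exchanges f r l) u"
  have un: "undecided f u" by (rule undecided_antimono[OF assms(2,3) u])
  have "\<not> fst (start_flags f r w)" if "(u, w) \<in> E" for w
    using quiet_neighbor[OF assms(2) un that] isolatedD[OF assms(1) un that] by blast
  moreover have "fst (start_flags f r u)"
    using un assms(4)[OF un] coin by (auto simp: start_flags_def undecided_def)
  ultimately have "fst (exchanges f r l u)"
    by (intro exchanges_survive)
  then show False using u by (simp add: undecided_def)
qed

section \<open>Irrelevance of values outside the network\<close>

text \<open>This and the following congruences serve to replace the tapes, which exist also outside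
  \<open>U\<close>, by random histories with default choices there.\<close>

lemma beeper_cong:
  assumes "\<And>u. u \<in> U \<Longrightarrow> a u = a' u" "u \<in> U"
  shows "beeper a u = beeper a' u"
proof -
  have "u \<in> U \<Longrightarrow> u \<in> beep_layer a m \<longleftrightarrow> u \<in> beep_layer a' m" for u m
  proof (induction m arbitrary: u)
    case (Suc m)
    have "w \<in> beep_layer a m \<longleftrightarrow> w \<in> beep_layer a' m" if "(u, w) \<in> E" for w
      using Suc.IH[of w] that edges by auto
    then show ?case by (simp add: assms(1)[OF Suc.prems] cong: conj_cong)
  qed (simp add: assms(1))
  then show ?thesis using assms(2) by (simp add: beeper_def)
qed

lemma hears_cong:
  assumes "\<And>u. u \<in> U \<Longrightarrow> a u = a' u" "u \<in> U"
  shows "hears a u = hears a' u"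
proof -
  have "(u, w) \<in> E \<Longrightarrow> beeper a w = beeper a' w" for w
    using beeper_cong[of a a' w] assms edges by auto
  moreover have "beeper a u = beeper a' u" by (rule beeper_cong[OF assms])
  ultimately show ?thesis
    by (simp add: hears_def hears1_def hears2_def hears3_def cong: conj_cong)
qed

lemma exchanges_cong:
  assumes "\<And>u. u \<in> U \<Longrightarrow> f u = f' u" "\<And>u. u \<in> U \<Longrightarrow> r u = r' u" "u \<in> U"
  shows "exchanges f r k u = exchanges f' r' k u"
  using assms(3)
proof (induction k arbitrary: u)
  case 0
  then show ?case using assms(1,2) by (simp add: start_flags_def)
next
  case (Suc k)
  have "hears (candidate (exchanges f r k) r k) u = hears (candidate (exchanges f' r' k) r' k) u"
    by (rule hears_cong) (use Suc assms(2) in \<open>auto simp: candidate_def\<close>)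
  then show ?case using Suc by (simp add: Let_def)
qed

lemma locked_cong:
  assumes "\<And>u. u \<in> U \<Longrightarrow> f u = f' u" "u \<in> U"
  shows "locked f u = locked f' u"
proof -
  have "f w = f' w" if "(u, w) \<in> E" for w using assms(1)[of w] that edges by auto
  then show ?thesis by (simp add: locked_def assms(1)[OF assms(2)] cong: conj_cong)
qed

end

section \<open>The order of the steps\<close>

fun next_step :: "nat \<times> nat \<Rightarrow> nat \<times> nat" where
  "next_step (x, i) = (if i < x then (x, Suc i) else (Suc x, 0))"

primrec step_index :: "nat \<Rightarrow> nat \<times> nat" where
  "step_index 0 = (1, 0)"
| "step_index (Suc j) = next_step (step_index j)"

text \<open>Loop \<open>y\<close> consists of the \<open>y + 1\<close> steps
  \<open>i = 0, ..., y\<close>, and the first loop has \<open>x = 1\<close>.\<close>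

definition loop_start :: "nat \<Rightarrow> nat" where
  "loop_start x = (\<Sum>y\<in>{1..<x}. y + 1)"

lemma loop_start_Suc: "1 \<le> x \<Longrightarrow> loop_start (Suc x) = loop_start x + (x + 1)"
  by (simp add: loop_start_def)

lemma step_index_inverse:
  "1 \<le> fst (step_index j) \<and> snd (step_index j) \<le> fst (step_index j) \<and>
   j = loop_start (fst (step_index j)) + snd (step_index j)"
proof (induction j)
  case 0
  then show ?case by (simp add: loop_start_def)
next
  case (Suc j)
  then show ?case by (cases "step_index j") (auto simp: loop_start_Suc)
qed

lemma step_index_pos: "0 < fst (step_index j)"
  using step_index_inverse[of j] by simp

text \<open>Distinct steps read distinct tape cells, whence their independence in
  \<open>prob_cylinder\<close>.\<close>

lemma inj_step_index: "inj step_index"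
  by (rule injI) (metis step_index_inverse)

lemma step_index_loop:
  assumes "1 \<le> x" "i \<le> x"
  shows "step_index (loop_start x + i) = (x, i)"
proof -
  have "step_index (loop_start x) = (x, 0) \<Longrightarrow> i \<le> x \<Longrightarrow> step_index (loop_start x + i) = (x, i)" for x i
    by (induction i) auto
  moreover have "step_index (loop_start x) = (x, 0)"
    using assms(1)
  proof (induction x rule: dec_induct)
    case base
    then show ?case by (simp add: loop_start_def)
  next
    case (step x)
    then have "step_index (loop_start x + x) = (x, x)"
      using calculation by simp
    then show ?case using step by (simp add: loop_start_Suc)
  qed
  ultimately show ?thesis using assms(2) by simp
qed

lemma loop_start_mono: "x \<le> y \<Longrightarrow> loop_start x \<le> loop_start y"
  unfolding loop_start_def by (intro sum_mono2) auto

lemma loop_start_le: "loop_start x \<le> x * x"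
  by (induction x) (auto simp: loop_start_def algebra_simps atLeastLessThanSuc)

lemma step_index_le:
  assumes "j < loop_start (Suc x)"
  shows "fst (step_index j) \<le> x"
proof (rule ccontr)
  assume "\<not> ?thesis"
  then have "loop_start (Suc x) \<le> loop_start (fst (step_index j))"
    by (intro loop_start_mono) simp
  then show False using step_index_inverse[of j] assms by linarith
qed

section \<open>The random choices\<close>

lemma expectation_le:
  assumes "finite (set_pmf p)" "\<And>x. x \<in> set_pmf p \<Longrightarrow> f x \<le> (C::real)"
  shows "measure_pmf.expectation p f \<le> C"
  by (rule measure_pmf.integral_le_const)
    (use assms in \<open>auto intro: integrable_measure_pmf_finite simp: AE_measure_pmf_iff\<close>)

lemma expectation_mono:
  assumes "finite (set_pmf p)" "\<And>x. x \<in> set_pmf p \<Longrightarrow> f x \<le> (g x::real)"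
  shows "measure_pmf.expectation p f \<le> measure_pmf.expectation p g"
  by (rule integral_mono_AE)
    (use assms in \<open>auto intro: integrable_measure_pmf_finite simp: AE_measure_pmf_iff\<close>)

lemma expectation_bind:
  assumes "finite (set_pmf p)" "\<And>x. x \<in> set_pmf p \<Longrightarrow> finite (set_pmf (q x))"
  shows "measure_pmf.expectation (bind_pmf p q) f =
    measure_pmf.expectation p (\<lambda>x. measure_pmf.expectation (q x) (f :: _ \<Rightarrow> real))"
  by (subst pmf_expectation_bind[where A = "set_pmf p"])
    (use assms in \<open>auto simp: integral_measure_pmf_real[of "set_pmf p"] mult.commute\<close>)

lemma finite_bool_lists: "finite {Y :: bool list. length Y = n}"
  using finite_lists_length_eq[of "UNIV :: bool set" n] by simp

lemma card_bool_lists: "card {Y :: bool list. length Y = n} = 2 ^ n"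
  using card_lists_length_eq[of "UNIV :: bool set" n] by simp

lemma bool_lists_nonempty: "{Y :: bool list. length Y = n} \<noteq> {}"
  by (auto intro: exI[of _ "replicate n True"])

lemma set_step_choice:
  assumes "0 < c * x"
  shows "set_pmf (step_choice c x i) \<subseteq> {(b, X). length X = c * x \<and> (\<exists>k<c * x. X ! k) \<and> (i = 0 \<longrightarrow> b)}"
proof -
  have certain: "b" if "b \<in> set_pmf (bernoulli_pmf 1)" for b
    using that by (cases b) (simp_all add: set_pmf_eq)
  then show ?thesis
    unfolding step_choice_def
    using assms bool_lists_nonempty[of "c * x"]
    by (auto simp: set_pmf_of_set finite_bool_lists lessThan_empty_iff dest: certain intro!: exI)
qed

lemma finite_set_step_choice:
  assumes "0 < c * x"
  shows "finite (set_pmf (step_choice c x i))"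
  by (rule finite_subset[OF set_step_choice[OF assms]],
      rule finite_subset[of _ "UNIV \<times> {X. length X = c * x}"]) (auto simp: finite_bool_lists)

lemma map_fst_step_choice: "map_pmf fst (step_choice c x i) = bernoulli_pmf (1 / 2 ^ i)"
  by (simp add: step_choice_def map_bind_pmf bind_return_pmf')

lemma prob_fst_step_choice:
  "measure_pmf.prob (step_choice c x i) {r. fst r = b} = (if b then 1 / 2 ^ i else 1 - 1 / 2 ^ i)"
proof -
  have "measure_pmf.prob (step_choice c x i) {r. fst r = b} =
      measure_pmf.prob (map_pmf fst (step_choice c x i)) {b}"
    by (simp add: vimage_def)
  also have "\<dots> = (if b then 1 / 2 ^ i else 1 - 1 / 2 ^ i)"
    unfolding map_fst_step_choice by (cases b) (auto simp: measure_pmf_single)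
  finally show ?thesis .
qed

text \<open>Forcing one entry to \<open>True\<close> identifies at most two of the uniformly distributed vectors.\<close>

lemma prob_snd_step_choice:
  assumes "0 < c * x"
  shows "measure_pmf.prob (step_choice c x i) {r. snd r = y} \<le> 2 / 2 ^ (c * x)"
proof -
  let ?Y = "pmf_of_set {Y :: bool list. length Y = c * x}"
  have inner: "measure_pmf.prob ?Y {Y. Y[j := True] = y} \<le> 2 / 2 ^ (c * x)" for j
  proof -
    have "{Y. length Y = c * x} \<inter> {Y. Y[j := True] = y} \<subseteq> {y[j := True], y[j := False]}"
    proof
      fix Y assume "Y \<in> {Y. length Y = c * x} \<inter> {Y. Y[j := True] = y}"
      then have y: "y = Y[j := True]" by simp
      have "Y = Y[j := Y ! j]" by simp
      then show "Y \<in> {y[j := True], y[j := False]}"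
        by (cases "Y ! j") (simp_all add: y)
    qed
    then have "card ({Y. length Y = c * x} \<inter> {Y. Y[j := True] = y}) \<le> card {y[j := True], y[j := False]}"
      by (intro card_mono) auto
    also have "\<dots> \<le> 2" by (rule order_trans[OF card_insert_le_m1]) auto
    finally have "real (card ({Y. length Y = c * x} \<inter> {Y. Y[j := True] = y})) \<le> 2" by linarith
    then show ?thesis
      using bool_lists_nonempty[of "c * x"]
      by (auto simp: measure_pmf_of_set finite_bool_lists card_bool_lists divide_right_mono)
  qed
  have fin: "finite (set_pmf ?Y)" "finite (set_pmf (pmf_of_set {..<c * x}))"
    using assms bool_lists_nonempty[of "c * x"]
    by (auto simp: finite_bool_lists lessThan_empty_iff)
  \<comment> \<open>Drawing the forced position first allows the bound \<open>inner\<close> to be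
    applied for each fixed \<open>j\<close>.\<close>
  have "map_pmf snd (step_choice c x i) =
      do { j \<leftarrow> pmf_of_set {..<c * x}; map_pmf (\<lambda>Y. Y[j := True]) ?Y }"
    by (simp add: step_choice_def map_bind_pmf map_pmf_def bind_assoc_pmf bind_return_pmf)
      (rule bind_commute_pmf)
  moreover have "measure_pmf.prob (step_choice c x i) {r. snd r = y} =
      measure_pmf.prob (map_pmf snd (step_choice c x i)) {y}"
    by (simp add: vimage_def)
  ultimately have "measure_pmf.prob (step_choice c x i) {r. snd r = y} =
      measure_pmf.prob (do { j \<leftarrow> pmf_of_set {..<c * x}; map_pmf (\<lambda>Y. Y[j := True]) ?Y }) {y}"
    by simp
  also have "\<dots> = measure_pmf.expectation
      (do { j \<leftarrow> pmf_of_set {..<c * x}; map_pmf (\<lambda>Y. Y[j := True]) ?Y }) (indicator {y})"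
    by simp
  also have "\<dots> = measure_pmf.expectation (pmf_of_set {..<c * x})
      (\<lambda>j. measure_pmf.prob ?Y {Y. Y[j := True] = y})"
    by (subst expectation_bind) (use fin in \<open>auto simp: vimage_def\<close>)
  also have "\<dots> \<le> 2 / 2 ^ (c * x)"
    by (rule expectation_le) (use fin inner in auto)
  finally show ?thesis .
qed

text \<open>Bernoulli's inequality for the full exponent gives only 0; for half of it, an integer
  since \<open>1 \<le> k\<close>, it gives 1/2, and squaring yields 1/4. The use with
  \<open>k = i - 1\<close> is why \<open>2 \<le> i\<close> is required in
  \<open>degree_two_steps\<close>.\<close>

lemma half_power_bound: "1 / 4 \<le> (1 - 1 / 2 ^ k :: real) ^ (2 ^ k)" if "1 \<le> k"
proof -
  obtain l where k: "k = Suc l" using \<open>1 \<le> k\<close> by (cases k) auto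
  have "1 + real (2 ^ l) * (- 1 / 2 ^ k) \<le> (1 + (- 1 / 2 ^ k)) ^ (2 ^ l)"
    by (rule Bernoulli_inequality) (simp add: field_simps)
  then have "1 / 2 \<le> (1 - 1 / 2 ^ k :: real) ^ (2 ^ l)"
    by (simp add: k)
  then have "(1 / 2)\<^sup>2 \<le> ((1 - 1 / 2 ^ k :: real) ^ (2 ^ l))\<^sup>2"
    by (intro power_mono) auto
  also have "\<dots> = (1 - 1 / 2 ^ k) ^ (2 ^ k)"
    by (simp add: k power_mult [symmetric] mult.commute)
  finally show ?thesis by (simp add: power2_eq_square)
qed

section \<open>Expected progress\<close>

locale synced_algorithm3 = synced_network U E wake
  for U :: "'v set" and E wake +
  fixes c :: nat
  assumes c_ge_2: "2 \<le> c"
begin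

section \<open>The law of the choices of one step\<close>

definition steplen :: "nat \<Rightarrow> nat" where
  "steplen j = c * fst (step_index j)"

lemma steplen_pos: "0 < steplen j"
  using c_ge_2 step_index_pos[of j] by (simp add: steplen_def)

definition run :: "nat \<Rightarrow> 'v flags \<Rightarrow> 'v choices \<Rightarrow> 'v flags" where
  "run j f r = exchanges f r (steplen j)"

primrec flags_at :: "(nat \<Rightarrow> 'v choices) \<Rightarrow> nat \<Rightarrow> 'v flags" where
  "flags_at h 0 = (\<lambda>_. (False, False))"
| "flags_at h (Suc j) = run j (flags_at h j) (h j)"

lemma flags_at_cong: "(\<And>i. i < j \<Longrightarrow> h i = h' i) \<Longrightarrow> flags_at h j = flags_at h' j"
  by (induction j) auto

text \<open>The default outside \<open>U\<close> makes every function in the support determined by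
  its values on \<open>U\<close>.\<close>

definition step_choices :: "nat \<Rightarrow> 'v choices pmf" where
  "step_choices j = Pi_pmf U (False, []) (\<lambda>_. step_choice c (fst (step_index j)) (snd (step_index j)))"

text \<open>Besides \<open>distinguishing\<close> it bundles two properties of the whole support, so
  that it fails only through a collision but makes the conclusions about a step
  deterministic.\<close>

definition good :: "nat \<Rightarrow> 'v choices \<Rightarrow> bool" where
  "good j r \<longleftrightarrow> proper (steplen j) r \<and> distinguishing r \<and> (snd (step_index j) = 0 \<longrightarrow> (\<forall>u\<in>U. fst (r u)))"

lemma finite_set_step_choices: "finite (set_pmf (step_choices j))"
  unfolding step_choices_def using steplen_pos[of j]
  by (subst set_Pi_pmf[OF finite_U]) (auto intro!: finite_PiE_dflt finite_U finite_set_step_choice simp: steplen_def)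

lemma good_if_distinguishing:
  assumes "r \<in> set_pmf (step_choices j)" "distinguishing r"
  shows "good j r"
proof -
  have "r u \<in> set_pmf (step_choice c (fst (step_index j)) (snd (step_index j)))" if "u \<in> U" for u
    using assms(1) that by (auto simp: step_choices_def set_Pi_pmf[OF finite_U] PiE_dflt_def)
  then have "length (snd (r u)) = steplen j \<and> (\<exists>k<steplen j. snd (r u) ! k) \<and>
      (snd (step_index j) = 0 \<longrightarrow> fst (r u))" if "u \<in> U" for u
    using set_step_choice[of c "fst (step_index j)"] that steplen_pos[of j]
    unfolding steplen_def by fastforce
  then show ?thesis using assms(2) by (auto simp: good_def proper_def)
qed

lemma prob_coins:
  assumes "T \<subseteq> U"
  shows "measure_pmf.prob (step_choices j) {r. \<forall>y\<in>T. fst (r y) = b y} =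
    (\<Prod>y\<in>T. if b y then 1 / 2 ^ snd (step_index j) else 1 - 1 / 2 ^ snd (step_index j))"
proof -
  let ?p = "step_choice c (fst (step_index j)) (snd (step_index j))"
  let ?B = "\<lambda>y. if y \<in> T then {r. fst r = b y} else UNIV"
  have "{r :: 'v choices. \<forall>y\<in>T. fst (r y) = b y} = Pi U ?B"
    using assms by (auto simp: Pi_def)
  then have "measure_pmf.prob (step_choices j) {r. \<forall>y\<in>T. fst (r y) = b y} =
      measure_pmf.prob (step_choices j) (Pi U ?B)"
    by simp
  also have "\<dots> = (\<Prod>y\<in>U. measure_pmf.prob ?p (?B y))"
    unfolding step_choices_def by (rule measure_Pi_pmf_Pi[OF finite_U])
  also have "\<dots> = (\<Prod>y\<in>T. measure_pmf.prob ?p (?B y))"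
    by (rule prod.mono_neutral_right[OF finite_U assms]) auto
  finally show ?thesis by (simp add: prob_fst_step_choice cong: if_cong)
qed

text \<open>By independence this is the sum of the squared point probabilities, at most the largest
  of them times the total mass 1.\<close>

lemma prob_collision:
  assumes "u \<in> U" "w \<in> U" "u \<noteq> w"
  shows "measure_pmf.prob (step_choices j) {r. snd (r u) = snd (r w)} \<le> 2 / 2 ^ steplen j"
proof -
  let ?p = "step_choice c (fst (step_index j)) (snd (step_index j))"
  let ?S = "snd ` set_pmf ?p"
  let ?q = "\<lambda>y. measure_pmf.prob ?p {r. snd r = y}"
  have fin: "finite ?S"
    using finite_set_step_choice[of c "fst (step_index j)"] steplen_pos[of j] by (simp add: steplen_def)
  let ?A = "\<lambda>y. {r :: 'v choices. snd (r u) = y \<and> snd (r w) = y}"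
  have both: "measure_pmf.prob (step_choices j) (?A y) = ?q y * ?q y" for y
  proof -
    have "?A y = Pi U (\<lambda>z. if z \<in> {u, w} then {r. snd r = y} else UNIV)"
      using assms by (auto simp: Pi_def)
    then have "measure_pmf.prob (step_choices j) (?A y) = measure_pmf.prob (step_choices j)
        (Pi U (\<lambda>z. if z \<in> {u, w} then {r. snd r = y} else UNIV))"
      by simp
    also have "\<dots> = (\<Prod>z\<in>U. measure_pmf.prob ?p (if z \<in> {u, w} then {r. snd r = y} else UNIV))"
      unfolding step_choices_def by (rule measure_Pi_pmf_Pi[OF finite_U])
    also have "\<dots> = (\<Prod>z\<in>{u, w}. measure_pmf.prob ?p (if z \<in> {u, w} then {r. snd r = y} else UNIV))"
      by (rule prod.mono_neutral_right[OF finite_U]) (use assms in auto)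
    finally show ?thesis using assms(3) by simp
  qed
  have "measure_pmf.prob (step_choices j) {r. snd (r u) = snd (r w)} \<le>
      measure_pmf.prob (step_choices j) (\<Union>y\<in>?S. ?A y)"
  proof (rule measure_pmf.finite_measure_mono_AE)
    have "r \<in> (\<Union>y\<in>?S. ?A y)" if "r \<in> set_pmf (step_choices j)" "snd (r u) = snd (r w)" for r
    proof (rule UN_I)
      show "snd (r u) \<in> ?S"
        using that(1) assms(1) by (auto simp: step_choices_def set_Pi_pmf[OF finite_U] PiE_dflt_def)
      show "r \<in> ?A (snd (r u))" using that(2) by simp
    qed
    then show "AE r in step_choices j. r \<in> {r. snd (r u) = snd (r w)} \<longrightarrow> r \<in> (\<Union>y\<in>?S. ?A y)"
      unfolding AE_measure_pmf_iff by simp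
  qed simp
  also have "\<dots> \<le> (\<Sum>y\<in>?S. measure_pmf.prob (step_choices j) (?A y))"
    by (rule measure_pmf.finite_measure_subadditive_finite) (use fin in auto)
  also have "\<dots> \<le> (\<Sum>y\<in>?S. 2 / 2 ^ steplen j * ?q y)"
    unfolding both steplen_def
    by (intro sum_mono mult_right_mono prob_snd_step_choice) (use steplen_pos[of j] in \<open>auto simp: steplen_def\<close>)
  also have "\<dots> = 2 / 2 ^ steplen j * (\<Sum>y\<in>?S. ?q y)"
    by (simp add: sum_distrib_left)
  also have "(\<Sum>y\<in>?S. ?q y) = measure_pmf.prob ?p (\<Union>y\<in>?S. {r. snd r = y})"
    by (rule measure_pmf.finite_measure_finite_Union[symmetric]) (use fin in \<open>auto simp: disjoint_family_on_def\<close>)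
  also have "2 / 2 ^ steplen j * \<dots> \<le> 2 / 2 ^ steplen j * 1"
    by (intro mult_left_mono) auto
  finally show ?thesis by simp
qed

lemma prob_not_good:
  "measure_pmf.prob (step_choices j) {r. \<not> good j r} \<le> (real (card U))\<^sup>2 * (2 / 2 ^ steplen j)"
proof -
  have fin: "finite E" using edges finite_U by (auto intro: finite_subset)
  have "measure_pmf.prob (step_choices j) {r. \<not> good j r} \<le>
      measure_pmf.prob (step_choices j) (\<Union>(u, w)\<in>E. {r. snd (r u) = snd (r w)})"
    by (rule measure_pmf.finite_measure_mono_AE)
      (use good_if_distinguishing in \<open>fastforce simp: AE_measure_pmf_iff distinguishing_def\<close>)+
  also have "\<dots> \<le> (\<Sum>e\<in>E. measure_pmf.prob (step_choices j) (case e of (u, w) \<Rightarrow> {r. snd (r u) = snd (r w)}))"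
    by (rule measure_pmf.finite_measure_subadditive_finite) (use fin in auto)
  also have "\<dots> \<le> (\<Sum>e\<in>E. 2 / 2 ^ steplen j)"
    using edges irrefl_E
    by (intro sum_mono) (auto intro!: prob_collision simp: irrefl_def split: prod.split)
  also have "\<dots> = real (card E) * (2 / 2 ^ steplen j)" by simp
  also have "\<dots> \<le> (real (card U))\<^sup>2 * (2 / 2 ^ steplen j)"
  proof (rule mult_right_mono)
    have "card E \<le> card (U \<times> U)" using edges finite_U by (intro card_mono) auto
    then show "real (card E) \<le> (real (card U))\<^sup>2"
      by (simp add: card_cartesian_product power2_eq_square flip: of_nat_mult)
  qed simp
  finally show ?thesis .
qed

section \<open>Expectation operators for sequences of steps\<close>

text \<open>
  \<open>kernels a n g f\<close> is the expectation of \<open>g\<close> after the steps \<open>a, \<dots>, a + n - 1\<close>, starting from the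
  flags \<open>f\<close>; runs with a step that is not good count as \<open>0\<close>.
\<close>

definition kernel :: "nat \<Rightarrow> ('v flags \<Rightarrow> real) \<Rightarrow> 'v flags \<Rightarrow> real" where
  "kernel j g f = measure_pmf.expectation (step_choices j) (\<lambda>r. if good j r then g (run j f r) else 0)"

primrec kernels :: "nat \<Rightarrow> nat \<Rightarrow> ('v flags \<Rightarrow> real) \<Rightarrow> 'v flags \<Rightarrow> real" where
  "kernels a 0 g = g"
| "kernels a (Suc n) g = kernels a n (kernel (a + n) g)"

lemma kernels_add: "kernels a (m + n) g = kernels a m (kernels (a + m) n g)"
  by (induction n arbitrary: g) (auto simp: add.assoc)

lemma kernel_le:
  assumes "\<And>r. good j r \<Longrightarrow> g (run j f r) \<le> C" "0 \<le> C"
  shows "kernel j g f \<le> C"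
  unfolding kernel_def by (rule expectation_le[OF finite_set_step_choices]) (use assms in auto)

text \<open>Discarded runs contribute 0: therefore \<open>I\<close> has to survive good steps only,
  and \<open>C\<close> has to be nonnegative.\<close>

lemma kernels_le:
  assumes stable: "\<And>j f r. I f \<Longrightarrow> good j r \<Longrightarrow> I (run j f r)"
    and "\<And>f. I f \<Longrightarrow> g f \<le> C" "0 \<le> C" "I f"
  shows "kernels a n g f \<le> C"
  using assms(2,4)
proof (induction n arbitrary: g)
  case (Suc n)
  show ?case
    unfolding kernels.simps
    by (rule Suc.IH) (auto intro!: kernel_le Suc.prems stable assms(3))
qed auto

lemma kernels_mono:
  assumes stable: "\<And>j f r. I f \<Longrightarrow> good j r \<Longrightarrow> I (run j f r)"
    and "\<And>f. I f \<Longrightarrow> g f \<le> g' f" "I f"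
  shows "kernels a n g f \<le> kernels a n g' f"
  using assms(2,3)
proof (induction n arbitrary: g g')
  case (Suc n)
  have "kernel (a + n) g f \<le> kernel (a + n) g' f" if "I f" for f
    unfolding kernel_def
    by (rule expectation_mono[OF finite_set_step_choices]) (use Suc.prems stable[OF that] in auto)
  then show ?case unfolding kernels.simps by (intro Suc.IH) (auto intro: Suc.prems)
qed auto

lemma kernels_decreasing:
  assumes stable: "\<And>j f r. I f \<Longrightarrow> good j r \<Longrightarrow> I (run j f r)"
    and dec: "\<And>j f r. I f \<Longrightarrow> good j r \<Longrightarrow> g (run j f r) \<le> g f"
    and "I f" "0 \<le> g f"
  shows "kernels a n g f \<le> g f"
  by (rule kernels_le[where I = "\<lambda>f'. I f' \<and> g f' \<le> g f"])
    (use assms in \<open>auto intro: order_trans[OF dec]\<close>)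

lemma kernels_sum: "kernels a n (\<lambda>f. \<Sum>u\<in>A. g u f) = (\<lambda>f. \<Sum>u\<in>A. kernels a n (g u) f)"
proof (induction n arbitrary: g)
  case (Suc n)
  have "kernel (a + n) (\<lambda>f. \<Sum>u\<in>A. g u f) = (\<lambda>f. \<Sum>u\<in>A. kernel (a + n) (g u) f)"
  proof
    fix f
    have "kernel (a + n) (\<lambda>f. \<Sum>u\<in>A. g u f) f =
        measure_pmf.expectation (step_choices (a + n))
          (\<lambda>r. \<Sum>u\<in>A. if good (a + n) r then g u (run (a + n) f r) else 0)"
      unfolding kernel_def by (intro Bochner_Integration.integral_cong) auto
    also have "\<dots> = (\<Sum>u\<in>A. kernel (a + n) (g u) f)"
      unfolding kernel_def
      by (rule Bochner_Integration.integral_sum)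
        (rule integrable_measure_pmf_finite[OF finite_set_step_choices])
    finally show "kernel (a + n) (\<lambda>f. \<Sum>u\<in>A. g u f) f = (\<Sum>u\<in>A. kernel (a + n) (g u) f)" .
  qed
  then show ?case by (simp add: Suc.IH)
qed simp

lemma kernels_scale: "kernels a n (\<lambda>f. C * g f) = (\<lambda>f. C * kernels a n g f)"
proof (induction n arbitrary: g)
  case (Suc n)
  have "kernel (a + n) (\<lambda>f. C * g f) = (\<lambda>f. C * kernel (a + n) g f)"
  proof
    fix f
    have "kernel (a + n) (\<lambda>f. C * g f) f =
        measure_pmf.expectation (step_choices (a + n))
          (\<lambda>r. C * (if good (a + n) r then g (run (a + n) f r) else 0))"
      unfolding kernel_def by (intro Bochner_Integration.integral_cong) auto
    then show "kernel (a + n) (\<lambda>f. C * g f) f = C * kernel (a + n) g f"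
      by (simp add: kernel_def)
  qed
  then show ?case by (simp add: Suc.IH)
qed simp

lemma all_locked_run: "good j r \<Longrightarrow> all_locked (run j f r)"
  by (simp add: run_def good_def all_locked_exchanges)

lemma degree_run: "all_locked f \<Longrightarrow> good j r \<Longrightarrow> degree (run j f r) u \<le> degree f u"
  by (simp add: run_def good_def degree_antimono)

lemma undecided_run: "all_locked f \<Longrightarrow> good j r \<Longrightarrow> undecided (run j f r) u \<Longrightarrow> undecided f u"
  unfolding run_def good_def by (rule undecided_antimono) auto

lemma kernels_degree: "all_locked f \<Longrightarrow> kernels a n (\<lambda>f. real (degree f u)) f \<le> degree f u"
  by (rule kernels_decreasing[where I = all_locked]) (auto simp: all_locked_run degree_run)

section \<open>Joining within two consecutive steps\<close>

lemma prob_coins_off: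
  assumes "T \<subseteq> U" "card T \<le> m" "snd (step_index j) = i"
  shows "(1 - 1 / 2 ^ i) ^ m \<le> measure_pmf.prob (step_choices j) {r. \<forall>y\<in>T. \<not> fst (r y)}"
proof -
  have "(1 - 1 / 2 ^ i :: real) ^ m \<le> (1 - 1 / 2 ^ i) ^ card T"
    by (rule power_decreasing) (use assms(2) in auto)
  also have "\<dots> = measure_pmf.prob (step_choices j) {r. \<forall>y\<in>T. \<not> fst (r y)}"
    using prob_coins[OF assms(1), of j "\<lambda>_. False"] assms(3) by simp
  finally show ?thesis .
qed

lemma prob_lone_coin:
  assumes "w \<in> U" "T \<subseteq> U" "w \<notin> T" "card T \<le> m" "snd (step_index j) = i"
  shows "1 / 2 ^ i * (1 - 1 / 2 ^ i) ^ m \<le>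
    measure_pmf.prob (step_choices j) {r. fst (r w) \<and> (\<forall>y\<in>T. \<not> fst (r y))}"
proof -
  have fin: "finite T" using assms(2) finite_U finite_subset by blast
  have "(1 - 1 / 2 ^ i :: real) ^ m \<le> (1 - 1 / 2 ^ i) ^ card T"
    by (rule power_decreasing) (use assms(4) in auto)
  then have "1 / 2 ^ i * (1 - 1 / 2 ^ i :: real) ^ m \<le> 1 / 2 ^ i * (1 - 1 / 2 ^ i) ^ card T"
    by (intro mult_left_mono) auto
  also have "(1 - 1 / 2 ^ i :: real) ^ card T = (\<Prod>y\<in>T. if y = w then 1 / 2 ^ i else 1 - 1 / 2 ^ i)"
  proof -
    have "(\<Prod>y\<in>T. if y = w then 1 / 2 ^ i else 1 - 1 / 2 ^ i :: real) = (\<Prod>y\<in>T. 1 - 1 / 2 ^ i)"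
      by (rule prod.cong) (use assms(3) in auto)
    then show ?thesis by simp
  qed
  also have "1 / 2 ^ i * \<dots> = (\<Prod>y\<in>insert w T. if y = w then 1 / 2 ^ i else 1 - 1 / 2 ^ i)"
    using fin assms(3) by simp
  also have "\<dots> = measure_pmf.prob (step_choices j) {r. \<forall>y\<in>insert w T. fst (r y) = (y = w)}"
    using prob_coins[of "insert w T" j "\<lambda>y. y = w"] assms(1,2) unfolding assms(5) by simp
  also have "{r. \<forall>y\<in>insert w T. fst (r y) = (y = w)} = {r :: 'v choices. fst (r w) \<and> (\<forall>y\<in>T. \<not> fst (r y))}"
    using assms(3) by auto
  finally show ?thesis .
qed

text \<open>
  The events considered for distinct members \<open>w\<close> of \<open>S\<close> are disjoint, because in the second step
  \<open>w\<close> is required to be the only member of \<open>S\<close> that tries to join.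
\<close>

lemma degree_two_steps:
  assumes ok: "all_locked f"
    and i: "2 \<le> i" "snd (step_index j) = i - 1" "snd (step_index (Suc j)) = i"
    and S: "S \<subseteq> undecided_nbrs f u" "card S \<le> d" "\<And>w. w \<in> S \<Longrightarrow> card (undecided_nbrs f w) \<le> d"
    and d: "d \<le> 2 ^ i" "2 ^ i \<le> 4 * d"
  shows "kernels j 2 (\<lambda>f. real (degree f u)) f \<le> real (degree f u) * (1 - real (card S) / (1024 * d))"
proof -
  \<comment> \<open>Neighbourhoods are taken in \<open>f\<close> for both steps; the undecided
    neighbours after the first step are among them.\<close>
  define N where "N w = undecided_nbrs f w" for w
  define B where "B w = {r :: 'v choices. \<forall>y\<in>N w. \<not> fst (r y)}" for w
  define A where "A w = {r :: 'v choices. fst (r w) \<and> (\<forall>y\<in>(N w \<union> S) - {w}. \<not> fst (r y))}" for w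
  define D where "D = real (degree f u)"
  have finS: "finite S" using S(1) by (rule finite_subset) simp
  have SU: "S \<subseteq> U" "N w \<subseteq> U" for w
    using S(1) undecided_nbrs_subset by (auto simp: N_def)
  have Sw: "undecided f w" "(u, w) \<in> E" if "w \<in> S" for w
    using S(1) that by (auto simp: undecided_nbrs_def)
  have D0: "0 \<le> D" by (simp add: D_def)
  have lone: "(\<Sum>w\<in>S. indicator (B w) r1 * indicator (A w) r2 :: real) \<in> {0, 1}" for r1 r2
  proof (cases "\<exists>w\<in>S. r2 \<in> A w")
    case True
    then obtain w where w: "w \<in> S" "r2 \<in> A w" by auto
    then have "r2 \<notin> A y" if "y \<in> S - {w}" for y
      using that by (auto simp: A_def)
    then have "(\<Sum>w\<in>S. indicator (B w) r1 * indicator (A w) r2 :: real) = indicator (B w) r1 * indicator (A w) r2"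
      using finS w(1) by (subst sum.remove[of S w]) (auto intro!: sum.neutral)
    then show ?thesis by (auto simp: indicator_def)
  qed (auto intro!: sum.neutral)
  have joins: "degree (run (Suc j) (run j f r1) r2) u = 0"
    if "w \<in> S" "good j r1" "good (Suc j) r2" "r1 \<in> B w" "r2 \<in> A w" for w r1 r2
  proof -
    have loop: "(w, w) \<notin> E" using irrefl_E by (auto simp: irrefl_def)
    have "fst (run (Suc j) (run j f r1) r2 w)"
      unfolding run_def
      by (rule lone_candidate_joins[OF ok Sw(1)[OF that(1)]])
        (use that loop in \<open>auto simp: good_def A_def B_def N_def undecided_nbrs_def\<close>)
    then have "\<not> undecided (run (Suc j) (run j f r1) r2) u"
      using Sw(2)[OF that(1)] by (auto simp: undecided_def)
    then show ?thesis by (simp add: degree_def)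
  qed
  have point: "real (degree (run (Suc j) (run j f r1) r2) u) \<le>
      D * (1 - (\<Sum>w\<in>S. indicator (B w) r1 * indicator (A w) r2))"
    if g: "good j r1" "good (Suc j) r2" for r1 r2
  proof (cases "(\<Sum>w\<in>S. indicator (B w) r1 * indicator (A w) r2 :: real) = 0")
    case True
    have "degree (run (Suc j) (run j f r1) r2) u \<le> degree f u"
      using degree_run[OF all_locked_run[OF g(1)] g(2)] degree_run[OF ok g(1)] order_trans by blast
    then show ?thesis using True by (simp add: D_def)
  next
    case False
    then obtain w where "w \<in> S" "indicator (B w) r1 * indicator (A w) r2 \<noteq> (0::real)"
      by (metis (no_types, lifting) sum.neutral)
    then have "degree (run (Suc j) (run j f r1) r2) u = 0"
      using joins[of w r1 r2] g by (auto simp: indicator_def split: if_splits)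
    moreover have "(\<Sum>w\<in>S. indicator (B w) r1 * indicator (A w) r2 :: real) = 1"
      using lone[of r1 r2] False by auto
    ultimately show ?thesis by simp
  qed
  have average: "measure_pmf.expectation (step_choices k) (\<lambda>r. D * (1 - (\<Sum>w\<in>S. b w * indicator (X w) r))) =
      D * (1 - (\<Sum>w\<in>S. b w * measure_pmf.prob (step_choices k) (X w)))" for k b X
  proof -
    have int: "integrable (step_choices k) (h :: _ \<Rightarrow> real)" for h
      by (rule integrable_measure_pmf_finite[OF finite_set_step_choices])
    have "measure_pmf.expectation (step_choices k) (\<lambda>r. D * (1 - (\<Sum>w\<in>S. b w * indicator (X w) r))) =
        D * measure_pmf.expectation (step_choices k) (\<lambda>r. 1 - (\<Sum>w\<in>S. b w * indicator (X w) r))"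
      by simp
    also have "measure_pmf.expectation (step_choices k) (\<lambda>r. 1 - (\<Sum>w\<in>S. b w * indicator (X w) r)) =
        1 - measure_pmf.expectation (step_choices k) (\<lambda>r. \<Sum>w\<in>S. b w * indicator (X w) r)"
      by (subst Bochner_Integration.integral_diff) (auto intro: int)
    also have "measure_pmf.expectation (step_choices k) (\<lambda>r. \<Sum>w\<in>S. b w * indicator (X w) r) =
        (\<Sum>w\<in>S. b w * measure_pmf.prob (step_choices k) (X w))"
      by (subst Bochner_Integration.integral_sum) (auto intro: int)
    finally show ?thesis .
  qed
  let ?PA = "\<lambda>w. measure_pmf.prob (step_choices (Suc j)) (A w)"
  let ?PB = "\<lambda>w. measure_pmf.prob (step_choices j) (B w)"
  have second: "kernel (Suc j) (\<lambda>f. real (degree f u)) (run j f r1) \<le>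
      D * (1 - (\<Sum>w\<in>S. indicator (B w) r1 * ?PA w))" if "good j r1" for r1
  proof -
    have "kernel (Suc j) (\<lambda>f. real (degree f u)) (run j f r1) \<le>
      measure_pmf.expectation (step_choices (Suc j))
        (\<lambda>r. D * (1 - (\<Sum>w\<in>S. indicator (B w) r1 * indicator (A w) r)))"
      unfolding kernel_def
    proof (rule expectation_mono[OF finite_set_step_choices])
      fix r2
      have "0 \<le> D * (1 - (\<Sum>w\<in>S. indicator (B w) r1 * indicator (A w) r2))"
        using lone[of r1 r2] D0 by auto
      then show "(if good (Suc j) r2 then real (degree (run (Suc j) (run j f r1) r2) u) else 0)
         \<le> D * (1 - (\<Sum>w\<in>S. indicator (B w) r1 * indicator (A w) r2))"
        using point[OF that] by simp
    qed
    then show ?thesis by (simp only: average)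
  qed
  have "kernels j 2 (\<lambda>f. real (degree f u)) f = kernel j (kernel (Suc j) (\<lambda>f. real (degree f u))) f"
    by (simp add: numeral_2_eq_2)
  also have "\<dots> \<le> measure_pmf.expectation (step_choices j)
        (\<lambda>r. D * (1 - (\<Sum>w\<in>S. ?PA w * indicator (B w) r)))"
    unfolding kernel_def[of j]
  proof (rule expectation_mono[OF finite_set_step_choices])
    fix r1
    have "0 \<le> measure_pmf.expectation (step_choices (Suc j))
        (\<lambda>r. D * (1 - (\<Sum>w\<in>S. indicator (B w) r1 * indicator (A w) r)))"
      by (rule Bochner_Integration.integral_nonneg) (use lone[of r1] D0 in \<open>force intro: mult_nonneg_nonneg\<close>)
    then have "0 \<le> D * (1 - (\<Sum>w\<in>S. indicator (B w) r1 * ?PA w))"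
      unfolding average .
    then show "(if good j r1 then kernel (Suc j) (\<lambda>f. real (degree f u)) (run j f r1) else 0)
       \<le> D * (1 - (\<Sum>w\<in>S. ?PA w * indicator (B w) r1))"
      using second[of r1] by (simp add: mult.commute)
  qed
  also have "\<dots> = D * (1 - (\<Sum>w\<in>S. ?PA w * ?PB w))"
    by (rule average)
  also have "\<dots> \<le> D * (1 - real (card S) / (1024 * d))"
  proof -
    have "1 / (1024 * real d) \<le> ?PA w * ?PB w" if w: "w \<in> S" for w
    proof -
      have cN: "card (N w) \<le> d" using S(3)[OF w] by (simp add: N_def)
      \<comment> \<open>At most \<open>2 * d\<close> coins must be off, hence two factors 1/4 from
        \<open>half_power_bound\<close>.\<close>
      have cT: "card (N w \<union> S - {w}) \<le> 2 * 2 ^ i"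
        using card_Diff1_le[of "N w \<union> S" w] card_Un_le[of "N w" S] cN S(2) d(1) by linarith
      \<comment> \<open>The first step has bias \<open>1 / 2 ^ k\<close>, and at most
        \<open>d\<close>, hence at most \<open>2 * 2 ^ k\<close>, coins must be off: again two
        factors 1/4.\<close>
      obtain k where k: "i = Suc k" "1 \<le> k" using i(1) by (cases i) auto
      have "1 / 2 ^ i * (1 / 4)\<^sup>2 \<le> 1 / 2 ^ i * ((1 - 1 / 2 ^ i :: real) ^ 2 ^ i)\<^sup>2"
        using half_power_bound[of i] i(1) by (intro mult_left_mono power_mono) auto
      also have "((1 - 1 / 2 ^ i :: real) ^ 2 ^ i)\<^sup>2 = (1 - 1 / 2 ^ i) ^ (2 * 2 ^ i)"
        by (simp add: power_mult [symmetric] mult.commute)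
      also have "1 / 2 ^ i * \<dots> \<le> ?PA w"
        unfolding A_def by (rule prob_lone_coin) (use w SU cT i(3) in auto)
      finally have PA: "1 / 2 ^ i * (1 / 4)\<^sup>2 \<le> ?PA w" .
      have "(1 / 4)\<^sup>2 \<le> ((1 - 1 / 2 ^ k :: real) ^ 2 ^ k)\<^sup>2"
        using half_power_bound[OF k(2)] by (intro power_mono) auto
      also have "\<dots> = (1 - 1 / 2 ^ k) ^ (2 ^ i)"
        by (simp add: k(1) power_mult [symmetric] mult.commute)
      also have "\<dots> \<le> ?PB w"
        unfolding B_def by (rule prob_coins_off) (use SU cN d(1) i(2) k in auto)
      finally have PB: "(1 / 4)\<^sup>2 \<le> ?PB w" .
      have d0: "0 < d" using d(2) by (cases d) auto
      have "(2 ^ i :: real) \<le> 4 * real d"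
        using d(2) by (metis of_nat_le_iff of_nat_mult of_nat_numeral of_nat_power)
      \<comment> \<open>The constant is 4 (from \<open>2 ^ i \<le> 4 * d\<close>) times
        \<open>4 ^ 4\<close> (from the four factors 1/4).\<close>
      then have "1 / (1024 * real d) \<le> 1 / 2 ^ i * (1 / 4)\<^sup>2 * (1 / 4)\<^sup>2"
        using d0 by (simp add: field_simps power2_eq_square)
      also have "\<dots> \<le> ?PA w * ?PB w"
        using PA PB by (intro mult_mono) auto
      finally show ?thesis .
    qed
    then have "(\<Sum>w\<in>S. 1 / (1024 * real d)) \<le> (\<Sum>w\<in>S. ?PA w * ?PB w)"
      by (rule sum_mono)
    then show ?thesis using D0 by (intro mult_left_mono) auto
  qed
  finally show ?thesis by (simp add: D_def)
qed

section \<open>Contraction of the potential\<close>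

text \<open>
  In the undecided graph, every edge is charged to an endpoint \<open>u\<close> of at least the degree of the
  other endpoint.
\<close>

definition lower_nbrs :: "'v flags \<Rightarrow> 'v \<Rightarrow> 'v set" where
  "lower_nbrs f u = {w \<in> undecided_nbrs f u. undecided f u \<and> degree f w \<le> degree f u}"

definition potential :: "'v flags \<Rightarrow> real" where
  "potential f = (\<Sum>u\<in>U. real (degree f u))"

text \<open>The ordered pairs of adjacent undecided nodes are covered by the charged pairs and their
  converses; this is the factor 2.\<close>

lemma potential_le_lower: "potential f \<le> 2 * (\<Sum>u\<in>U. real (card (lower_nbrs f u)))"
proof -
  let ?N = "\<lambda>u. if undecided f u then undecided_nbrs f u else {}"
  have fin: "finite (lower_nbrs f u)" for u
    by (simp add: lower_nbrs_def)
  have "(\<Sum>u\<in>U. degree f u) = card (Sigma U ?N)"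
    by (subst card_SigmaI) (auto simp: degree_def finite_U intro!: sum.cong)
  also have "\<dots> \<le> card (Sigma U (lower_nbrs f) \<union> (Sigma U (lower_nbrs f))\<inverse>)"
  proof (rule card_mono)
    show "Sigma U ?N \<subseteq> Sigma U (lower_nbrs f) \<union> (Sigma U (lower_nbrs f))\<inverse>"
      using edges by (auto simp: lower_nbrs_def undecided_nbrs_def edge_sym split: if_splits)
  qed (use fin finite_U in auto)
  also have "\<dots> \<le> card (Sigma U (lower_nbrs f)) + card ((Sigma U (lower_nbrs f))\<inverse>)"
    by (rule card_Un_le)
  also have "\<dots> = 2 * (\<Sum>u\<in>U. card (lower_nbrs f u))"
    using fin finite_U by (simp add: card_SigmaI)
  finally have "real (\<Sum>u\<in>U. degree f u) \<le> real (2 * (\<Sum>u\<in>U. card (lower_nbrs f u)))"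
    by (simp only: of_nat_le_iff)
  then show ?thesis by (simp add: potential_def)
qed

lemma loop_step_index: "1 \<le> x \<Longrightarrow> i \<le> x \<Longrightarrow> snd (step_index (loop_start x + i)) = i"
  by (simp add: step_index_loop)

text \<open>By the time the loop reaches the index that suits \<open>d\<close>, either half of the
  lower neighbours are still undecided, and the next two steps give an expected loss of
  \<open>card (lower_nbrs f u) / 2\<close> times 1/1024, or more than half are decided and the
  degree has already dropped by that many. The other steps of the loop cannot raise the
  degree.\<close>

lemma degree_loop:
  assumes ok: "all_locked f" and x: "2 \<le> x" "card U \<le> 2 ^ x"
  shows "kernels (loop_start x) (x + 1) (\<lambda>f. real (degree f u)) f \<le>
    real (degree f u) - real (card (lower_nbrs f u)) / 2048"
proof (cases "lower_nbrs f u = {}")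
  case True
  then show ?thesis
    using kernels_degree[OF ok, of "loop_start x" "x + 1" u] by (simp del: kernels.simps)
next
  case False
  let ?g = "\<lambda>f. real (degree f u)"
  define d where "d = degree f u"
  define L where "L = lower_nbrs f u"
  have u: "undecided f u" using False by (auto simp: lower_nbrs_def)
  have fin: "finite L" by (simp add: L_def lower_nbrs_def)
  have Lsub: "L \<subseteq> undecided_nbrs f u" by (auto simp: L_def lower_nbrs_def)
  have cardL: "card L \<le> d"
    using card_mono[OF _ Lsub] u by (simp add: d_def degree_def)
  have "card L > 0" using False fin by (simp add: L_def card_gt_0_iff)
  then have d1: "1 \<le> d" using cardL by simp
  have "d \<le> card U"
    using card_mono[OF finite_U undecided_nbrs_subset] u by (simp add: d_def degree_def)
  then have dx: "d \<le> 2 ^ x" using x(2) by simp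
  \<comment> \<open>Minimality gives \<open>2 ^ i \<le> 4 * d\<close>: either \<open>i = 2\<close>
    and \<open>d \<ge> 1\<close>, or \<open>2 ^ (i - 1) < d\<close>.\<close>
  define i where "i = (LEAST i. 2 \<le> i \<and> d \<le> 2 ^ i)"
  have i: "2 \<le> i" "d \<le> 2 ^ i"
    unfolding i_def using LeastI[of "\<lambda>i. 2 \<le> i \<and> d \<le> 2 ^ i" x] x(1) dx by auto
  have ix: "i \<le> x"
    unfolding i_def by (rule Least_le) (use x(1) dx in auto)
  have "2 ^ i \<le> 4 * d"
  proof (cases "i = 2")
    case True
    then show ?thesis using d1 by simp
  next
    case False
    then have "\<not> (2 \<le> i - 1 \<and> d \<le> 2 ^ (i - 1))"
      unfolding i_def by (intro not_less_Least) (use i(1) in \<open>auto simp: i_def\<close>)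
    then have "2 ^ (i - 1) < d" using False i(1) by auto
    moreover have "(2::nat) ^ i = 2 * 2 ^ (i - 1)" using i(1) by (cases i) auto
    ultimately show ?thesis by simp
  qed
  note i = i this
  let ?a = "loop_start x"
  let ?C = "real d - real (card L) / 2048"
  \<comment> \<open>The steps before \<open>i - 1\<close> lead to some flags \<open>h\<close>; the
    invariant records that they only shrink the undecided graph of \<open>f\<close>.\<close>
  let ?I = "\<lambda>h. all_locked h \<and> (\<forall>y. undecided h y \<longrightarrow> undecided f y)"
  have C0: "0 \<le> ?C" using cardL by simp
  have stable: "?I (run j h r)" if "?I h" "good j r" for j h r
    using that all_locked_run undecided_run by blast
  have middle: "kernels (?a + (i - 1)) 2 ?g h \<le> ?C" if h: "?I h" for h
  proof -
    have hok: "all_locked h" and hsub: "\<And>y. undecided h y \<Longrightarrow> undecided f y"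
      using h by auto
    show ?thesis
    proof (cases "undecided h u")
      case False
      then have "kernels (?a + (i - 1)) 2 ?g h \<le> 0"
        using kernels_degree[OF hok, of "?a + (i - 1)" 2 u] by (simp add: degree_def)
      then show ?thesis using C0 by linarith
    next
      case True
      define S where "S = {w \<in> L. undecided h w}"
      have NS: "undecided_nbrs h w \<subseteq> undecided_nbrs f w" for w
        using hsub by (auto simp: undecided_nbrs_def)
      have SL: "S \<subseteq> L" by (auto simp: S_def)
      have cS: "card S \<le> card L" by (rule card_mono[OF fin SL])
      have "kernels (?a + (i - 1)) 2 ?g h \<le> ?g h * (1 - real (card S) / (1024 * d))"
      proof (rule degree_two_steps[OF hok i(1)])
        show "snd (step_index (?a + (i - 1))) = i - 1"
          using ix x by (intro loop_step_index) auto
        show "snd (step_index (Suc (?a + (i - 1)))) = i"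
          using loop_step_index[of x i] ix x i(1) by simp
        show "S \<subseteq> undecided_nbrs h u"
          using Lsub by (auto simp: S_def undecided_nbrs_def)
        show "card S \<le> d" using cS cardL by simp
        fix w assume "w \<in> S"
        then have w: "undecided f w" "degree f w \<le> d"
          by (auto simp: S_def L_def lower_nbrs_def d_def undecided_nbrs_def)
        show "card (undecided_nbrs h w) \<le> d"
          using card_mono[OF _ NS[of w]] w by (simp add: degree_def)
      qed (use i in auto)
      also have "\<dots> \<le> ?C"
      \<comment> \<open>If at least half of \<open>L\<close> survives, the two steps win
        \<open>card S / 1024\<close>; otherwise the missing part \<open>L - S\<close> has already
        lowered the degree.\<close>
      proof (cases "card L \<le> 2 * card S")
        case True
        have "card S \<le> d" using cS cardL by simp
        then have "real (card S) / (1024 * d) \<le> 1"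
          using d1 by (simp add: field_simps)
        moreover have "?g h \<le> d"
          using card_mono[OF _ NS[of u]] \<open>undecided h u\<close> u by (simp add: d_def degree_def)
        ultimately have "?g h * (1 - real (card S) / (1024 * d)) \<le> d * (1 - real (card S) / (1024 * d))"
          by (intro mult_right_mono) auto
        also have "\<dots> = d - real (card S) / 1024"
          using d1 by (simp add: field_simps)
        also have "\<dots> \<le> ?C" using True by simp
        finally show ?thesis .
      next
        case False
        have "undecided_nbrs h u \<subseteq> undecided_nbrs f u - (L - S)"
          using NS[of u] by (auto simp: S_def undecided_nbrs_def)
        then have "card (undecided_nbrs h u) \<le> card (undecided_nbrs f u - (L - S))"
          by (intro card_mono) auto
        also have "\<dots> = d - (card L - card S)"
        proof -
          have "card (undecided_nbrs f u - (L - S)) = card (undecided_nbrs f u) - card (L - S)"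
            using fin Lsub by (intro card_Diff_subset) auto
          also have "card (L - S) = card L - card S"
            using finite_subset[OF SL fin] SL by (rule card_Diff_subset)
          finally show ?thesis using u by (simp add: d_def degree_def)
        qed
        finally have "degree h u \<le> d - (card L - card S)"
          using \<open>undecided h u\<close> by (simp add: degree_def)
        then have "2 * degree h u + card L \<le> 2 * d"
          using False cardL cS by arith
        then have "2 * ?g h + real (card L) \<le> 2 * real d"
          by (metis of_nat_add of_nat_le_iff of_nat_mult of_nat_numeral)
        then have "?g h \<le> ?C" by simp
        moreover have "?g h * (1 - real (card S) / (1024 * d)) \<le> ?g h * 1"
          by (intro mult_left_mono) auto
        ultimately show ?thesis by linarith
      qed
      finally show ?thesis .
    qed
  qed
  have split: "x + 1 = (i - 1) + (2 + (x - i))" using i(1) ix by simp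
  have "kernels ?a (x + 1) ?g f =
      kernels ?a (i - 1) (kernels (?a + (i - 1)) 2 (kernels (?a + (i - 1) + 2) (x - i) ?g)) f"
    unfolding split kernels_add ..
  also have "\<dots> \<le> ?C"
  proof (rule kernels_le[where I = ?I])
    fix h assume h: "?I h"
    have "kernels (?a + (i - 1)) 2 (kernels (?a + (i - 1) + 2) (x - i) ?g) h \<le> kernels (?a + (i - 1)) 2 ?g h"
      by (rule kernels_mono[where I = all_locked], erule all_locked_run, erule kernels_degree) (use h in blast)
    then show "kernels (?a + (i - 1)) 2 (kernels (?a + (i - 1) + 2) (x - i) ?g) h \<le> ?C"
      using middle[OF h] by linarith
  qed (rule stable, assumption+, rule C0, use ok in simp)
  finally show ?thesis by (simp only: d_def L_def)
qed

lemma potential_loop: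
  assumes "all_locked f" "2 \<le> x" "card U \<le> 2 ^ x"
  shows "kernels (loop_start x) (x + 1) potential f \<le> (1 - 1 / 4096) * potential f"
proof -
  have "kernels (loop_start x) (x + 1) potential f =
      (\<Sum>u\<in>U. kernels (loop_start x) (x + 1) (\<lambda>f. real (degree f u)) f)"
    unfolding potential_def kernels_sum ..
  also have "\<dots> \<le> (\<Sum>u\<in>U. real (degree f u) - real (card (lower_nbrs f u)) / 2048)"
    by (intro sum_mono degree_loop assms)
  also have "\<dots> = potential f - (\<Sum>u\<in>U. real (card (lower_nbrs f u))) / 2048"
    by (simp add: potential_def sum_subtractf sum_divide_distrib)
  also have "\<dots> \<le> (1 - 1 / 4096) * potential f"
    using potential_le_lower[of f] by simp
  finally show ?thesis .
qed

text \<open>The first loop is split off, so \<open>x\<close> and \<open>f\<close> are general in the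
  induction; \<open>card U \<le> 2 ^ x\<close> only gets weaker as \<open>x\<close> grows.\<close>

lemma potential_loops:
  assumes "all_locked f" "2 \<le> x" "card U \<le> 2 ^ x"
  shows "kernels (loop_start x) (loop_start (x + m) - loop_start x) potential f \<le> (1 - 1 / 4096) ^ m * potential f"
  using assms
proof (induction m arbitrary: x f)
  case 0
  then show ?case by simp
next
  case (Suc m)
  have le: "card U \<le> 2 ^ Suc x"
    using Suc.prems(3) by (rule order_trans) simp
  have *: "loop_start (x + Suc m) - loop_start x = (x + 1) + (loop_start (Suc x + m) - loop_start (Suc x))"
    using loop_start_Suc[of x] Suc.prems(2) loop_start_mono[of "Suc x" "Suc x + m"] by simp
  have "kernels (loop_start x) (loop_start (x + Suc m) - loop_start x) potential f =
     kernels (loop_start x) (x + 1) (kernels (loop_start (Suc x)) (loop_start (Suc x + m) - loop_start (Suc x)) potential) f"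
    unfolding * kernels_add using loop_start_Suc[of x] Suc.prems(2) by simp
  also have "\<dots> \<le> kernels (loop_start x) (x + 1) (\<lambda>f. (1 - 1 / 4096) ^ m * potential f) f"
    by (rule kernels_mono[where I = all_locked])
      (use Suc.prems Suc.IH[OF _ _ le] in \<open>auto simp: all_locked_run\<close>)
  also have "\<dots> = (1 - 1 / 4096) ^ m * kernels (loop_start x) (x + 1) potential f"
    by (simp only: kernels_scale)
  also have "\<dots> \<le> (1 - 1 / 4096) ^ m * ((1 - 1 / 4096) * potential f)"
    by (intro mult_left_mono potential_loop Suc.prems) auto
  finally show ?case by simp
qed

section \<open>From vanishing potential to resolution\<close>

definition resolved :: "'v flags \<Rightarrow> bool" where
  "resolved f \<longleftrightarrow> (\<forall>u\<in>U. locked f u \<or> (\<exists>w. (u, w) \<in> E \<and> locked f w))"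

lemma resolved_run: "resolved f \<Longrightarrow> good j r \<Longrightarrow> resolved (run j f r)"
  using locked_persists by (fastforce simp: resolved_def run_def good_def)

lemma resolved_if_decided:
  assumes "all_locked f" "\<And>u. \<not> undecided f u"
  shows "resolved f"
  unfolding resolved_def
proof
  fix u assume u: "u \<in> U"
  then have "fst (f u) \<or> (\<exists>w. (u, w) \<in> E \<and> fst (f w))"
    using assms(2)[of u] by (auto simp: undecided_def)
  then show "locked f u \<or> (\<exists>w. (u, w) \<in> E \<and> locked f w)"
    using assms(1) u edges by (auto simp: all_locked_def)
qed

definition failure :: "'v flags \<Rightarrow> real" where
  "failure f = (if resolved f then 0 else 1)"

text \<open>
  Isolated undecided nodes hear nothing during the first loop and join for certain at the beginning
  of the second one, where the coin has bias \<open>1\<close>.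
\<close>

lemma failure_le_potential:
  assumes ok: "all_locked f" and x: "1 \<le> x"
  shows "kernels (loop_start x) (loop_start (x + 2) - loop_start x) failure f \<le> potential f"
proof (cases "isolated f")
  \<comment> \<open>Markov's inequality in effect: the potential is a nonnegative integer, so it is
    at least 1 unless all nodes are isolated.\<close>
  case False
  have "kernels (loop_start x) (loop_start (x + 2) - loop_start x) failure f \<le> 1"
    by (rule kernels_le[where I = "\<lambda>_. True"]) (auto simp: failure_def)
  also obtain u where "u \<in> U" "degree f u \<noteq> 0" using False by (auto simp: isolated_def)
  then have "1 \<le> potential f"
    unfolding potential_def
    by (intro order_trans[OF _ member_le_sum[of u]]) (auto simp: finite_U)
  finally show ?thesis .
next
  case True
  let ?I = "\<lambda>h. isolated h \<and> all_locked h \<and> (\<forall>u. undecided h u \<longrightarrow> \<not> snd (h u))"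
  have first: "?I (run j h r)" if "isolated h" "all_locked h" "good j r" for j h r
    using that isolated_exchanges isolated_free all_locked_run[OF that(3), of h]
    by (auto simp: run_def good_def)
  let ?a = "loop_start x" and ?b = "loop_start (Suc x)"
  have b: "?b = ?a + Suc x" using x by (simp add: loop_start_Suc)
  \<comment> \<open>The first step of loop \<open>x\<close> clears \<open>z\<close>, its other
    \<open>x\<close> steps preserve this, step 0 of the next loop lets all undecided nodes join, and
    its last \<open>x + 1\<close> steps preserve \<open>resolved\<close>.\<close>
  have len: "loop_start (x + 2) - ?a = 1 + (x + (1 + (x + 1)))"
    using x by (simp add: loop_start_Suc)
  let ?g1 = "kernels (?b + 1) (x + 1) failure"
  have g1: "?g1 h \<le> 0" if "resolved h" for h
    by (rule kernels_le[where I = resolved]) (use that resolved_run in \<open>auto simp: failure_def\<close>)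
  let ?g2 = "kernels ?b 1 ?g1"
  have g2: "?g2 h \<le> 0" if h: "?I h" for h
  proof -
    have "resolved (run ?b h r)" if r: "good ?b r" for r
    proof (rule resolved_if_decided)
      have "snd (step_index ?b) = 0" using loop_step_index[of "Suc x" 0] by simp
      then show "\<not> undecided (run ?b h r) u" for u
        using isolated_joins[of h "steplen ?b" r] h r by (auto simp: run_def good_def)
    qed (rule all_locked_run[OF r])
    then have "kernel ?b ?g1 h \<le> 0" by (intro kernel_le g1) auto
    then show ?thesis by simp
  qed
  let ?g3 = "kernels (?a + 1) x ?g2"
  have g3: "?g3 h \<le> 0" if "?I h" for h
    by (rule kernels_le[where I = ?I]) (use that first g2 in auto)
  have "kernels ?a (1 + (x + (1 + (x + 1)))) failure f = kernels ?a 1 ?g3 f"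
    unfolding kernels_add b by (simp add: add.assoc)
  also have "\<dots> = kernel ?a ?g3 f" by simp
  also have "\<dots> \<le> 0"
    by (intro kernel_le g3) (use True ok first in auto)
  also have "\<dots> \<le> potential f" by (simp add: potential_def sum_nonneg)
  finally show ?thesis by (simp only: len)
qed

lemma potential_le: "potential f \<le> (real (card U))\<^sup>2"
proof -
  have "degree f u \<le> card U" for u
    using card_mono[OF finite_U undecided_nbrs_subset] by (simp add: degree_def)
  then have "potential f \<le> (\<Sum>u\<in>U. real (card U))"
    unfolding potential_def by (intro sum_mono) auto
  then show ?thesis by (simp add: power2_eq_square)
qed

text \<open>The \<open>m + 3\<close> loops are one whose last step establishes
  \<open>all_locked\<close> from arbitrary flags, \<open>m\<close> loops of contraction, and two to
  turn a small potential into resolution.\<close>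

lemma failure_window:
  assumes x: "1 \<le> x" "card U \<le> 2 ^ x"
  shows "kernels (loop_start x) (loop_start (x + m + 3) - loop_start x) failure f \<le>
    (1 - 1 / 4096) ^ m * (real (card U))\<^sup>2"
proof -
  let ?b = "loop_start (Suc x)" and ?d = "loop_start (Suc x + m)"
  let ?n = "?d - ?b" and ?k = "loop_start (Suc x + m + 2) - ?d"
  have b: "?b = loop_start x + Suc x" using x by (simp add: loop_start_Suc)
  have d: "?d = ?b + ?n" using loop_start_mono[of "Suc x" "Suc x + m"] by simp
  have le: "card U \<le> 2 ^ Suc x" using x(2) by (rule order_trans) simp
  have len: "loop_start (x + m + 3) - loop_start x = x + (1 + (?n + ?k))"
    using b d loop_start_mono[of "Suc x + m" "Suc x + m + 2"] by (simp add: eval_nat_numeral)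
  let ?g = "kernels ?b (?n + ?k) failure"
  let ?C = "(1 - 1 / 4096) ^ m * (real (card U))\<^sup>2"
  have g: "?g h \<le> ?C" if h: "all_locked h" for h
  proof -
    have "?g h = kernels ?b ?n (kernels ?d ?k failure) h"
      unfolding kernels_add using d by simp
    also have "\<dots> \<le> kernels ?b ?n potential h"
      by (rule kernels_mono[where I = all_locked]) (use h all_locked_run failure_le_potential in auto)
    also have "\<dots> \<le> (1 - 1 / 4096) ^ m * potential h"
      by (rule potential_loops) (use h le x in auto)
    also have "\<dots> \<le> ?C"
      by (intro mult_left_mono potential_le) auto
    finally show ?thesis .
  qed
  have "kernels (loop_start x) (x + (1 + (?n + ?k))) failure f =
      kernels (loop_start x) x (kernel (loop_start x + x) ?g) f"
    unfolding kernels_add b by (simp add: add.assoc)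
  also have "\<dots> \<le> ?C"
  proof (rule kernels_le[where I = "\<lambda>_. True"])
    show "kernel (loop_start x + x) ?g h \<le> ?C" for h
      by (rule kernel_le) (rule g[OF all_locked_run], assumption, simp)
  qed auto
  finally show ?thesis by (simp only: len)
qed

section \<open>Random histories and the failure probability\<close>

definition histories :: "nat \<Rightarrow> (nat \<Rightarrow> 'v choices) pmf" where
  "histories N = Pi_pmf {..<N} (\<lambda>_. (False, [])) step_choices"

lemma finite_set_histories: "finite (set_pmf (histories N))"
  unfolding histories_def
  by (subst set_Pi_pmf) (auto intro!: finite_PiE_dflt finite_set_step_choices)

lemma histories_Suc:
  "histories (Suc N) = do { h \<leftarrow> histories N; r \<leftarrow> step_choices N; return_pmf (h(N := r)) }"
proof -
  have "histories (Suc N) = do { r \<leftarrow> step_choices N; h \<leftarrow> histories N; return_pmf (h(N := r)) }"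
    unfolding histories_def lessThan_Suc by (rule Pi_pmf_insert') auto
  also have "\<dots> = do { h \<leftarrow> histories N; r \<leftarrow> step_choices N; return_pmf (h(N := r)) }"
    by (rule bind_commute_pmf)
  finally show ?thesis .
qed

text \<open>Identifies the operators with actual expectations. Goodness is required from step
  \<open>a\<close> on only, because collisions are likely while \<open>x\<close> is small.\<close>

lemma expectation_histories:
  "measure_pmf.expectation (histories (a + n))
     (\<lambda>h. if \<forall>j\<in>{a..<a + n}. good j (h j) then g (flags_at h (a + n)) else 0) =
   measure_pmf.expectation (histories a) (\<lambda>h. kernels a n g (flags_at h a))"
proof (induction n arbitrary: g)
  case (Suc n)
  let ?N = "a + n"
  let ?F = "\<lambda>h. if \<forall>j\<in>{a..<a + Suc n}. good j (h j) then g (flags_at h (a + Suc n)) else 0"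
  have "measure_pmf.expectation (histories (a + Suc n)) ?F =
      measure_pmf.expectation (histories ?N)
        (\<lambda>h. measure_pmf.expectation (step_choices ?N) (\<lambda>r. ?F (h(?N := r))))"
    unfolding add_Suc_right histories_Suc
    by (simp add: expectation_bind finite_set_histories finite_set_step_choices del: add_Suc_right kernels.simps flags_at.simps)
  also have "\<dots> = measure_pmf.expectation (histories ?N)
     (\<lambda>h. if \<forall>j\<in>{a..<?N}. good j (h j) then kernel ?N g (flags_at h ?N) else 0)"
  proof (rule Bochner_Integration.integral_cong[OF refl])
    fix h :: "nat \<Rightarrow> 'v choices"
    have eq: "?F (h(?N := r)) = (if \<forall>j\<in>{a..<?N}. good j (h j) then
        if good ?N r then g (run ?N (flags_at h ?N) r) else 0 else 0)" for r
      using flags_at_cong[of ?N "h(?N := r)" h] by (auto simp: atLeastLessThanSuc)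
    then show "measure_pmf.expectation (step_choices ?N) (\<lambda>r. ?F (h(?N := r))) =
        (if \<forall>j\<in>{a..<?N}. good j (h j) then kernel ?N g (flags_at h ?N) else 0)"
      by (cases "\<forall>j\<in>{a..<?N}. good j (h j)") (simp_all only: eq kernel_def if_True if_False, simp_all)
  qed
  also have "\<dots> = measure_pmf.expectation (histories a) (\<lambda>h. kernels a (Suc n) g (flags_at h a))"
    using Suc.IH[of "kernel ?N g"] by simp
  finally show ?case .
qed simp

text \<open>As \<open>2 \<le> c\<close>, each of the \<open>y + 1 \<le> 2 ^ y\<close> steps of loop
  \<open>y\<close> contributes at most \<open>2 / 4 ^ y\<close>. The loop contributes at most
  \<open>2 / 2 ^ y = 4 / 2 ^ y - 4 / 2 ^ (y + 1)\<close>, which telescopes.\<close>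

lemma sum_collision_bounds:
  assumes "1 \<le> x"
  shows "(\<Sum>j\<in>{loop_start x..<loop_start (x + m)}. 2 / 2 ^ steplen j :: real) \<le> 4 / 2 ^ x - 4 / 2 ^ (x + m)"
proof (induction m)
  case (Suc m)
  let ?y = "x + m"
  have y: "loop_start (Suc ?y) = loop_start ?y + (?y + 1)" "loop_start x \<le> loop_start ?y"
    using assms loop_start_mono[of x ?y] by (simp_all add: loop_start_Suc)
  have "(\<Sum>j\<in>{loop_start ?y..<loop_start (Suc ?y)}. 2 / 2 ^ steplen j :: real) \<le>
      (\<Sum>j\<in>{loop_start ?y..<loop_start (Suc ?y)}. 2 / 2 ^ (2 * ?y))"
  proof (intro sum_mono divide_left_mono power_increasing)
    fix j assume "j \<in> {loop_start ?y..<loop_start (Suc ?y)}"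
    then have "j = loop_start ?y + (j - loop_start ?y)" "j - loop_start ?y \<le> ?y"
      using y by auto
    then have "fst (step_index j) = ?y"
      using step_index_loop[of ?y "j - loop_start ?y"] assms by auto
    then show "2 * ?y \<le> steplen j" using mult_right_mono[OF c_ge_2, of ?y] by (simp add: steplen_def)
  qed auto
  also have "\<dots> = real (Suc ?y) * 2 / (2 ^ ?y * 2 ^ ?y)"
    using y by (simp add: mult_2 power_add)
  also have "\<dots> \<le> 2 ^ ?y * 2 / (2 ^ ?y * 2 ^ ?y)"
  proof (intro divide_right_mono mult_right_mono)
    have "Suc ?y \<le> 2 ^ ?y" by (rule Suc_leI, rule less_exp)
    then show "real (Suc ?y) \<le> 2 ^ ?y" by (metis of_nat_le_iff of_nat_numeral of_nat_power)
  qed auto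
  also have "\<dots> = 4 / 2 ^ ?y - 4 / 2 ^ Suc ?y" by (simp add: field_simps)
  finally have last: "(\<Sum>j\<in>{loop_start ?y..<loop_start (Suc ?y)}. 2 / 2 ^ steplen j :: real) \<le>
      4 / 2 ^ ?y - 4 / 2 ^ Suc ?y" .
  have "(\<Sum>j\<in>{loop_start x..<loop_start (x + Suc m)}. 2 / 2 ^ steplen j :: real) =
      (\<Sum>j\<in>{loop_start x..<loop_start ?y}. 2 / 2 ^ steplen j) +
      (\<Sum>j\<in>{loop_start ?y..<loop_start (Suc ?y)}. 2 / 2 ^ steplen j)"
    using y by (simp add: sum.atLeastLessThan_concat)
  then show ?case using Suc.IH last by simp
qed simp

text \<open>Either some step from loop \<open>x\<close> on is bad, which the union bound controls,
  or all are good and \<open>failure_window\<close> applies.\<close>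

lemma prob_unresolved:
  assumes x: "1 \<le> x" "card U \<le> 2 ^ x" and J: "J = loop_start (x + m + 3)"
  shows "measure_pmf.prob (histories J) {h. \<not> resolved (flags_at h J)} \<le>
    (real (card U))\<^sup>2 * (4 / 2 ^ x + (1 - 1 / 4096) ^ m)"
proof -
  let ?a = "loop_start x"
  have aJ: "J = ?a + (J - ?a)" unfolding J using loop_start_mono[of x "x + m + 3"] by simp
  let ?P = "measure_pmf.prob (histories J)"
  let ?G = "{h. (\<forall>j\<in>{?a..<J}. good j (h j)) \<and> \<not> resolved (flags_at h J)}"
  let ?B = "\<Union>j\<in>{?a..<J}. {h. \<not> good j (h j)}"
  have "?P {h. \<not> resolved (flags_at h J)} \<le> ?P (?G \<union> ?B)"
    by (rule measure_pmf.finite_measure_mono) auto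
  also have "\<dots> \<le> ?P ?G + ?P ?B"
    by (rule measure_Un_le) auto
  also have "?P ?G \<le> (1 - 1 / 4096) ^ m * (real (card U))\<^sup>2"
  proof -
    have "?P ?G = measure_pmf.expectation (histories J) (indicator ?G)" by simp
    also have "\<dots> = measure_pmf.expectation (histories J)
        (\<lambda>h. if \<forall>j\<in>{?a..<J}. good j (h j) then failure (flags_at h J) else 0)"
      by (rule Bochner_Integration.integral_cong) (auto simp: failure_def indicator_def)
    also have "\<dots> = measure_pmf.expectation (histories ?a) (\<lambda>h. kernels ?a (J - ?a) failure (flags_at h ?a))"
      using expectation_histories[of ?a "J - ?a" failure] unfolding aJ[symmetric] .
    also have "\<dots> \<le> (1 - 1 / 4096) ^ m * (real (card U))\<^sup>2"
      unfolding J by (rule expectation_le[OF finite_set_histories]) (rule failure_window[OF x, of m])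
    finally show ?thesis .
  qed
  also have "?P ?B \<le> (\<Sum>j\<in>{?a..<J}. ?P {h. \<not> good j (h j)})"
    by (rule measure_pmf.finite_measure_subadditive_finite) auto
  also have "\<dots> \<le> (\<Sum>j\<in>{?a..<J}. (real (card U))\<^sup>2 * (2 / 2 ^ steplen j))"
  proof (rule sum_mono)
    fix j assume j: "j \<in> {?a..<J}"
    have "?P {h. \<not> good j (h j)} = measure_pmf.prob (map_pmf (\<lambda>h. h j) (histories J)) {r. \<not> good j r}"
      by (simp add: vimage_def)
    also have "map_pmf (\<lambda>h. h j) (histories J) = step_choices j"
      using j unfolding histories_def by (subst Pi_pmf_component) auto
    finally show "?P {h. \<not> good j (h j)} \<le> (real (card U))\<^sup>2 * (2 / 2 ^ steplen j)"
      using prob_not_good[of j] by simp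
  qed
  also have "\<dots> = (real (card U))\<^sup>2 * (\<Sum>j\<in>{?a..<J}. 2 / 2 ^ steplen j)"
    by (simp add: sum_distrib_left)
  also have "\<dots> \<le> (real (card U))\<^sup>2 * (4 / 2 ^ x)"
  proof (rule mult_left_mono)
    have "(\<Sum>j\<in>{?a..<J}. 2 / 2 ^ steplen j :: real) \<le> 4 / 2 ^ x - 4 / 2 ^ (x + (m + 3))"
      using sum_collision_bounds[OF x(1), of "m + 3"] by (simp add: J add.assoc)
    also have "\<dots> \<le> 4 / 2 ^ x" by simp
    finally show "(\<Sum>j\<in>{?a..<J}. 2 / 2 ^ steplen j :: real) \<le> 4 / 2 ^ x" .
  qed simp
  finally show ?thesis by (simp add: algebra_simps)
qed

lemma flags_at_cong_on:
  assumes "\<And>j u. j < N \<Longrightarrow> u \<in> U \<Longrightarrow> h j u = h' j u" "j \<le> N" "u \<in> U"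
  shows "flags_at h j u = flags_at h' j u"
  using assms(2,3)
proof (induction j arbitrary: u)
  case (Suc j)
  show ?case
    unfolding flags_at.simps run_def by (rule exchanges_cong) (use Suc assms(1) in auto)
qed simp

lemma resolved_cong:
  assumes "\<And>u. u \<in> U \<Longrightarrow> f u = f' u"
  shows "resolved f = resolved f'"
proof -
  have eq: "locked f u = locked f' u" if "u \<in> U" for u
    by (rule locked_cong[OF assms that])
  moreover have "locked f w = locked f' w" if "(u, w) \<in> E" for u w
    using eq[of w] that edges by auto
  ultimately show ?thesis by (simp add: resolved_def cong: conj_cong)
qed

end

section \<open>From rounds to steps\<close>

locale wakeup_schedule =
  fixes V :: "'v set" and E :: "('v \<times> 'v) set" and W :: "nat \<Rightarrow> 'v set" and c :: nat
  assumes network: "network V E"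
    and two_le_c: "2 \<le> c"
begin

lemma network_facts: "finite V" "E \<subseteq> V \<times> V" "(u, w) \<in> E \<Longrightarrow> (w, u) \<in> E" "(u, u) \<notin> E"
  using network by (auto simp: network_def irrefl_def dest: symD)

text \<open>
  Whether a node is awake does not depend on the coins: only the beep of the very first round of a
  node can reach a sleeping neighbour.
\<close>

primrec awake :: "nat \<Rightarrow> 'v set" where
  "awake 0 = V \<inter> W 0"
| "awake (Suc t) = awake t \<union> {u \<in> V. u \<in> W (Suc t) \<or> (\<exists>w. (u, w) \<in> E \<and> w \<in> awake t)}"

definition woken :: "'v set" where
  "woken = (\<Union>t. awake t)"

definition wake_time :: "'v \<Rightarrow> nat" where
  "wake_time u = (LEAST t. u \<in> awake t)"

lemma awake_mono: "s \<le> t \<Longrightarrow> awake s \<subseteq> awake t"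
  by (induction rule: dec_induct) auto

lemma awake_iff: "u \<in> awake t \<longleftrightarrow> u \<in> woken \<and> wake_time u \<le> t"
proof
  assume "u \<in> awake t"
  then show "u \<in> woken \<and> wake_time u \<le> t"
    by (auto simp: woken_def wake_time_def intro: Least_le)
next
  assume "u \<in> woken \<and> wake_time u \<le> t"
  then show "u \<in> awake t"
    using awake_mono[of "wake_time u" t] LeastI_ex[of "\<lambda>t. u \<in> awake t"]
    by (auto simp: woken_def wake_time_def)
qed

lemma awake_subset: "awake t \<subseteq> V"
  by (induction t) auto

lemma woken_subset: "woken \<subseteq> V"
  using awake_subset by (auto simp: woken_def)

lemma neighbor_woken:
  assumes "u \<in> woken" "(u, w) \<in> E"
  shows "w \<in> woken" "wake_time w \<le> Suc (wake_time u)"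
proof -
  have "u \<in> awake (wake_time u)" using assms(1) by (simp add: awake_iff)
  then have "w \<in> awake (Suc (wake_time u))"
    using assms(2) network_facts by auto
  then show "w \<in> woken" "wake_time w \<le> Suc (wake_time u)" by (simp_all only: awake_iff)
qed

definition active_edges :: "('v \<times> 'v) set" where
  "active_edges = E \<inter> woken \<times> woken"

lemma active_edges_iff: "u \<in> woken \<Longrightarrow> (u, w) \<in> active_edges \<longleftrightarrow> (u, w) \<in> E"
  using neighbor_woken by (auto simp: active_edges_def)

sublocale synced_algorithm3 woken active_edges wake_time c
proof unfold_locales
  show "finite woken" using woken_subset network_facts finite_subset by blast
  show "active_edges \<subseteq> woken \<times> woken" by (auto simp: active_edges_def)
  show "sym active_edges" using network_facts by (auto simp: active_edges_def sym_def)
  show "irrefl active_edges" using network_facts by (auto simp: active_edges_def irrefl_def)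
  show "wake_time w \<le> Suc (wake_time u)" if "(u, w) \<in> active_edges" for u w
    using that neighbor_woken by (auto simp: active_edges_def)
  show "2 \<le> c" by (rule two_le_c)
qed

section \<open>Closed form of the state of a node\<close>

text \<open>The \<open>q\<close>-th competition exchange of a node is the exchange \<open>k\<close> of step \<open>j\<close>.\<close>

primrec clock :: "nat \<Rightarrow> nat \<times> nat" where
  "clock 0 = (0, 0)"
| "clock (Suc q) = (case clock q of (j, k) \<Rightarrow> if k + 1 < steplen j then (j, k + 1) else (j + 1, 0))"

definition offset :: "nat \<Rightarrow> nat" where
  "offset j = (\<Sum>i<j. steplen i)"

lemma clock_inverse: "clock q = (j, k) \<Longrightarrow> k < steplen j \<and> q = offset j + k"
proof (induction q arbitrary: j k)
  case 0
  then show ?case using steplen_pos by (simp add: offset_def)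
next
  case (Suc q)
  obtain j' k' where jk: "clock q = (j', k')" by fastforce
  show ?case
    using Suc.IH[OF jk] Suc.prems jk steplen_pos[of "j' + 1"]
    by (auto simp: offset_def split: if_splits)
qed

lemma clock_after:
  assumes "offset J \<le> q" "clock q = (j, k)"
  shows "J \<le> j"
proof (rule ccontr)
  assume "\<not> J \<le> j"
  then have "offset (Suc j) \<le> offset J"
    unfolding offset_def by (intro sum_mono2) auto
  then show False using clock_inverse[OF assms(2)] assms(1) by (simp add: offset_def)
qed

definition history :: "('v \<Rightarrow> tape) \<Rightarrow> nat \<Rightarrow> 'v choices" where
  "history \<omega> j u = \<omega> u (step_index j)"

definition entry :: "('v \<Rightarrow> tape) \<Rightarrow> nat \<Rightarrow> 'v flags" where
  "entry \<omega> q = (case clock q of (j, k) \<Rightarrow> exchanges (flags_at (history \<omega>) j) (history \<omega> j) k)"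

definition contender :: "('v \<Rightarrow> tape) \<Rightarrow> nat \<Rightarrow> 'v \<Rightarrow> bool" where
  "contender \<omega> q = (case clock q of (j, k) \<Rightarrow> candidate (entry \<omega> q) (history \<omega> j) k)"

text \<open>Together with \<open>entry3\<close> this refines a synchronous exchange to the node's
  own rounds: these are the flags before its second and third round.\<close>

definition entry2 :: "('v \<Rightarrow> tape) \<Rightarrow> nat \<Rightarrow> 'v flags" where
  "entry2 \<omega> q u = heed (hears1 (contender \<omega> q) u) (entry \<omega> q u)"

definition entry3 :: "('v \<Rightarrow> tape) \<Rightarrow> nat \<Rightarrow> 'v flags" where
  "entry3 \<omega> q u = heed (hears2 (contender \<omega> q) u) (entry2 \<omega> q u)"

text \<open>Heeding a beep overwrites the flags with a fixed value, so heeding the three rounds in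
  turn amounts to heeding their disjunction.\<close>

lemma exchanges_Suc_entry3:
  assumes "clock q = (j, k)"
  shows "exchanges (flags_at (history \<omega>) j) (history \<omega> j) (Suc k) u = heed (hears3 (contender \<omega> q) u) (entry3 \<omega> q u)"
  using assms by (auto simp: entry_def entry2_def entry3_def contender_def hears_def heed_def Let_def)

definition node_at :: "('v \<Rightarrow> tape) \<Rightarrow> 'v \<Rightarrow> nat \<Rightarrow> phase \<Rightarrow> bool \<times> bool \<Rightarrow> node_state" where
  "node_at \<omega> u q p f =
     (case clock q of (j, k) \<Rightarrow>
        \<lparr> phase = p, estimate = fst (step_index j), index = snd (step_index j), exchange = k,
          v_flag = fst f, z_flag = snd f, competition = snd (history \<omega> j u) \<rparr>)"

text \<open>A prediction that \<open>run_of_eq\<close> confirms; \<open>l\<close> counts rounds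
  since waking, and exchange \<open>q\<close> occupies the rounds \<open>3 * q + 2\<close> to
  \<open>3 * q + 4\<close>.\<close>

definition local_state :: "('v \<Rightarrow> tape) \<Rightarrow> 'v \<Rightarrow> nat \<Rightarrow> node_state" where
  "local_state \<omega> u l =
     (if l = 0 then alg3_initial
      else if l = 1 then alg3_initial\<lparr>phase := Wait\<rparr>
      else let q = (l - 2) div 3 in
        if (l - 2) mod 3 = 0 then node_at \<omega> u q Round1 (entry \<omega> q u)
        else if (l - 2) mod 3 = 1 then node_at \<omega> u q Round2 (entry2 \<omega> q u)
        else node_at \<omega> u q Round3 (entry3 \<omega> q u))"

lemma local_state_simps:
  "local_state \<omega> u 0 = alg3_initial"
  "local_state \<omega> u (Suc 0) = alg3_initial\<lparr>phase := Wait\<rparr>"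
  "local_state \<omega> u (Suc (Suc (3 * q))) = node_at \<omega> u q Round1 (entry \<omega> q u)"
  "local_state \<omega> u (3 * q + 3) = node_at \<omega> u q Round2 (entry2 \<omega> q u)"
  "local_state \<omega> u (3 * q + 4) = node_at \<omega> u q Round3 (entry3 \<omega> q u)"
proof -
  have "(3 * q + 2) mod 3 = 2" by (subst mod_mult_self4) simp
  moreover have "3 * q + 3 - 2 = 3 * q + 1" "3 * q + 4 - 2 = 3 * q + 2"
    "(3 * q + 1) div 3 = q" "(3 * q + 1) mod 3 = 1" "(3 * q + 2) div 3 = q"
    by simp_all
  ultimately show "local_state \<omega> u (3 * q + 3) = node_at \<omega> u q Round2 (entry2 \<omega> q u)"
    "local_state \<omega> u (3 * q + 4) = node_at \<omega> u q Round3 (entry3 \<omega> q u)"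
    unfolding local_state_def Let_def by simp_all
qed (simp_all add: local_state_def)

lemma local_time_cases:
  obtains "l = 0" | "l = Suc 0" | q where "l = Suc (Suc (3 * q))" | q where "l = 3 * q + 3" | q where "l = 3 * q + 4"
proof -
  have "l = 0 \<or> l = Suc 0 \<or> (\<exists>q. l = Suc (Suc (3 * q)) \<or> l = 3 * q + 3 \<or> l = 3 * q + 4)" by presburger
  then show ?thesis using that by blast
qed

lemma node_at_simps:
  "phase (node_at \<omega> u q p f) = p"
  "v_flag (node_at \<omega> u q p f) = fst f"
  by (simp_all add: node_at_def split: prod.split)

lemma local_state_beeps:
  "alg3_beeps (local_state \<omega> u l) \<longleftrightarrow> l = 0 \<or> (\<exists>q. l = 3 * q + 3 \<and> beeper (contender \<omega> q) u)"
proof (cases l rule: local_time_cases)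
  case 1
  then show ?thesis by (simp add: local_state_simps alg3_beeps_def alg3_initial_def)
next
  case 2
  then show ?thesis by (simp add: local_state_simps alg3_beeps_def alg3_initial_def)
next
  case (3 q)
  have "Suc (Suc (3 * q)) \<noteq> 3 * q' + 3" for q' by presburger
  with 3 show ?thesis by (simp add: local_state_simps alg3_beeps_def node_at_simps)
next
  case (4 q)
  have "fst (entry2 \<omega> q u) \<and> competition (node_at \<omega> u q p f) ! exchange (node_at \<omega> u q p f)
      \<longleftrightarrow> beeper (contender \<omega> q) u" for p f
    by (auto simp: beeper_iff entry2_def contender_def candidate_def node_at_def heed_def split: prod.splits)
  then have "alg3_beeps (local_state \<omega> u l) \<longleftrightarrow> beeper (contender \<omega> q) u"
    unfolding 4 local_state_simps alg3_beeps_def node_at_simps by simp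
  moreover have "(\<exists>q'. l = 3 * q' + 3 \<and> P q') \<longleftrightarrow> P q" for P
    unfolding 4 by auto
  ultimately show ?thesis using 4 by simp
next
  case (5 q)
  have "3 * q + 4 \<noteq> 3 * q' + 3" for q' by presburger
  with 5 show ?thesis by (simp add: local_state_simps alg3_beeps_def node_at_simps)
qed

lemma react_node_at: "react h (node_at \<omega> u q p f) = node_at \<omega> u q p (heed h f)"
  by (simp add: react_def node_at_def heed_def split: prod.split)

lemma phase_update_node_at: "(node_at \<omega> u q p f)\<lparr>phase := p'\<rparr> = node_at \<omega> u q p' f"
  by (simp add: node_at_def split: prod.split)

lemma start_step_eq:
  assumes "clock q = (j, 0)" "(v_flag s, z_flag s) = flags_at (history \<omega>) j u"
  shows "start_step (\<omega> u) (fst (step_index j)) (snd (step_index j)) s = node_at \<omega> u q Round1 (entry \<omega> q u)"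
proof -
  have "flags_at (history \<omega>) j u = (v_flag s, z_flag s)" using assms(2) by simp
  then show ?thesis
    using assms(1) by (simp add: start_step_def node_at_def entry_def start_flags_def history_def)
qed

lemma finish_exchange_node_at:
  "finish_exchange c (\<omega> u) (node_at \<omega> u q Round3 (heed (hears3 (contender \<omega> q) u) (entry3 \<omega> q u))) =
    node_at \<omega> u (Suc q) Round1 (entry \<omega> (Suc q) u)"
proof -
  obtain j k where jk: "clock q = (j, k)" by fastforce
  let ?f = "exchanges (flags_at (history \<omega>) j) (history \<omega> j) (Suc k) u"
  let ?s = "node_at \<omega> u q Round3 ?f"
  have s: "exchange ?s = k" "estimate ?s = fst (step_index j)" "index ?s = snd (step_index j)"
    "v_flag ?s = fst ?f" "z_flag ?s = snd ?f"
    using jk by (simp_all add: node_at_def)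
  have "finish_exchange c (\<omega> u) ?s = node_at \<omega> u (Suc q) Round1 (entry \<omega> (Suc q) u)"
  proof (cases "k + 1 < steplen j")
    case True
    then have "clock (Suc q) = (j, k + 1)" using jk by simp
    moreover have "finish_exchange c (\<omega> u) ?s = ?s\<lparr>phase := Round1, exchange := k + 1\<rparr>"
      unfolding finish_exchange_def s using True by (simp add: steplen_def)
    ultimately show ?thesis using jk by (simp add: node_at_def entry_def)
  next
    case False
    then have clock: "clock (Suc q) = (Suc j, 0)" using jk by simp
    have "Suc k = steplen j" using False clock_inverse[OF jk] by simp
    then have "(v_flag ?s, z_flag ?s) = flags_at (history \<omega>) (Suc j) u"
      unfolding s by (simp add: run_def)
    from start_step_eq[OF clock this] show ?thesis
      unfolding finish_exchange_def s using False
      by (cases "step_index j") (auto simp: steplen_def)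
  qed
  then show ?thesis unfolding exchanges_Suc_entry3[OF jk] .
qed

text \<open>
  In each of the three rounds of an exchange a node hears precisely its neighbours that started one
  round earlier, at the same time, and one round later, respectively.
\<close>

lemma local_step:
  assumes u: "u \<in> woken" "wake_time u \<le> t"
    and h: "h \<longleftrightarrow> \<not> alg3_beeps (local_state \<omega> u (t - wake_time u)) \<and>
      (\<exists>w. (u, w) \<in> E \<and> wake_time w \<le> t \<and> alg3_beeps (local_state \<omega> w (t - wake_time w)))"
  shows "alg3_update c (\<omega> u) h (local_state \<omega> u (t - wake_time u)) = local_state \<omega> u (Suc t - wake_time u)"
proof -
  define l where "l = t - wake_time u"
  have t: "t = wake_time u + l" using u(2) by (simp add: l_def)
  have lSuc: "Suc t - wake_time u = Suc l" by (simp add: t)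
  \<comment> \<open>At \<open>l = 0\<close> this would be false: a neighbour that wakes one round
    later still sleeps, while the truncated \<open>l - 1\<close> would read as its wake-up
    beep.\<close>
  have heard: "(\<exists>w. (u, w) \<in> E \<and> wake_time w \<le> t \<and> alg3_beeps (local_state \<omega> w (t - wake_time w))) \<longleftrightarrow>
      (\<exists>w. (u, w) \<in> active_edges \<and>
        (wake_time u = Suc (wake_time w) \<and> alg3_beeps (local_state \<omega> w (Suc l)) \<or>
         wake_time w = wake_time u \<and> alg3_beeps (local_state \<omega> w l) \<or>
         wake_time w = Suc (wake_time u) \<and> alg3_beeps (local_state \<omega> w (l - 1))))"
    if "1 \<le> l"
  proof (intro iff_exI conj_cong)
    fix w
    show "(u, w) \<in> E \<longleftrightarrow> (u, w) \<in> active_edges" using u(1) by (simp add: active_edges_iff)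
    assume "(u, w) \<in> active_edges"
    then show "wake_time w \<le> t \<and> alg3_beeps (local_state \<omega> w (t - wake_time w)) \<longleftrightarrow>
        wake_time u = Suc (wake_time w) \<and> alg3_beeps (local_state \<omega> w (Suc l)) \<or>
         wake_time w = wake_time u \<and> alg3_beeps (local_state \<omega> w l) \<or>
         wake_time w = Suc (wake_time u) \<and> alg3_beeps (local_state \<omega> w (l - 1))"
      by (cases rule: wake_cases) (use that in \<open>simp_all add: t\<close>)
  qed
  have "alg3_update c (\<omega> u) h (local_state \<omega> u l) = local_state \<omega> u (Suc l)"
  proof (cases l rule: local_time_cases)
    case 1
    then show ?thesis by (simp add: local_state_simps alg3_update_def alg3_initial_def)
  next
    case 2
    \<comment> \<open>In this round the wake-up beep of a neighbour that woke one round later may be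
      heard; the waiting round exists to ignore it.\<close>
    have "clock 0 = (0, 0)" by simp
    from start_step_eq[OF this, of "alg3_initial\<lparr>phase := Wait\<rparr>" \<omega> u]
    have "alg3_update c (\<omega> u) h (local_state \<omega> u l) = node_at \<omega> u 0 Round1 (entry \<omega> 0 u)"
      using 2 by (simp add: local_state_simps alg3_update_def alg3_initial_def)
    then show ?thesis using 2 local_state_simps(3)[of \<omega> u 0] by (simp add: numeral_2_eq_2)
  next
    case (3 q)
    have s: "Suc l = 3 * q + 3" using 3 by auto
    have "1 \<le> l" "l \<noteq> 0" "Suc l \<noteq> 0" "l - 1 \<noteq> 0" using 3 by auto
    moreover have "Suc l = 3 * q' + 3 \<longleftrightarrow> q' = q" "l = 3 * q' + 3 \<longleftrightarrow> False" "l - 1 = 3 * q' + 3 \<longleftrightarrow> False" for q'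
      using 3 by presburger+
    ultimately have "h \<longleftrightarrow> hears1 (contender \<omega> q) u"
      unfolding h l_def[symmetric] hears1_def
      by (subst heard) (simp_all only: local_state_beeps, simp_all)
    then show ?thesis
      unfolding s unfolding 3
      by (simp add: local_state_simps alg3_update_def node_at_simps react_node_at phase_update_node_at entry2_def)
  next
    case (4 q)
    have s: "Suc l = 3 * q + 4" using 4 by auto
    have "1 \<le> l" "l \<noteq> 0" "Suc l \<noteq> 0" "l - 1 \<noteq> 0" using 4 by auto
    moreover have "Suc l = 3 * q' + 3 \<longleftrightarrow> False" "l = 3 * q' + 3 \<longleftrightarrow> q' = q" "l - 1 = 3 * q' + 3 \<longleftrightarrow> False" for q'
      using 4 by presburger+
    ultimately have "h \<longleftrightarrow> hears2 (contender \<omega> q) u"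
      unfolding h l_def[symmetric] hears2_def
      by (subst heard) (simp_all only: local_state_beeps, simp_all)
    then show ?thesis
      unfolding s unfolding 4
      by (simp add: local_state_simps alg3_update_def node_at_simps react_node_at phase_update_node_at entry3_def)
  next
    case (5 q)
    have s: "Suc l = Suc (Suc (3 * Suc q))" using 5 by auto
    have "1 \<le> l" "l \<noteq> 0" "Suc l \<noteq> 0" "l - 1 \<noteq> 0" using 5 by auto
    moreover have "Suc l = 3 * q' + 3 \<longleftrightarrow> False" "l = 3 * q' + 3 \<longleftrightarrow> False" "l - 1 = 3 * q' + 3 \<longleftrightarrow> q' = q" for q'
      using 5 by presburger+
    ultimately have "h \<longleftrightarrow> hears3 (contender \<omega> q) u"
      unfolding h l_def[symmetric] hears3_def
      by (subst heard) (simp_all only: local_state_beeps, simp_all)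
    then show ?thesis
      unfolding s local_state_simps unfolding 5 local_state_simps
      by (simp add: alg3_update_def node_at_simps react_node_at finish_exchange_node_at)
  qed
  then show ?thesis by (simp only: l_def lSuc)
qed

section \<open>Agreement with the execution\<close>

definition run_of :: "('v \<Rightarrow> tape) \<Rightarrow> nat \<Rightarrow> ('v, node_state) config" where
  "run_of \<omega> = execution (algorithm3 c) V E W \<omega>"

lemma algorithm3_simps [simp]:
  "initial (algorithm3 c) = alg3_initial" "beeps (algorithm3 c) = alg3_beeps"
  "update (algorithm3 c) = alg3_update c" "in_mis (algorithm3 c) = v_flag"
  "coins (algorithm3 c) = tape_distribution c"
  by (simp_all add: algorithm3_def)

lemma run_of_eq:
  "run_of \<omega> t u = (if u \<in> awake t then Some (local_state \<omega> u (t - wake_time u)) else None)"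
proof (induction t arbitrary: u)
  case 0
  then show ?case by (auto simp: run_of_def local_state_simps)
next
  case (Suc t)
  have nb: "neighbor_beeps (algorithm3 c) E (run_of \<omega> t) u \<longleftrightarrow>
      (\<exists>w. (u, w) \<in> E \<and> w \<in> awake t \<and> alg3_beeps (local_state \<omega> w (t - wake_time w)))" for u
    by (auto simp: neighbor_beeps_def beeping_def Suc.IH)
  show ?case
  proof (cases "u \<in> awake t")
    case True
    then have u: "u \<in> woken" "wake_time u \<le> t" by (auto simp: awake_iff)
    have "run_of \<omega> (Suc t) u = Some (alg3_update c (\<omega> u)
        (\<not> alg3_beeps (local_state \<omega> u (t - wake_time u)) \<and> neighbor_beeps (algorithm3 c) E (run_of \<omega> t) u)
        (local_state \<omega> u (t - wake_time u)))"
      using True Suc.IH[of u] by (simp add: run_of_def Let_def)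
    also have "\<dots> = Some (local_state \<omega> u (Suc t - wake_time u))"
      unfolding nb using neighbor_woken(1)[OF u(1)]
      by (subst local_step[OF u]) (auto simp: awake_iff)
    finally show ?thesis using True by simp
  next
    case False
    have "neighbor_beeps (algorithm3 c) E (run_of \<omega> t) u \<longleftrightarrow> (\<exists>w. (u, w) \<in> E \<and> w \<in> awake t)"
    proof -
      \<comment> \<open>Had \<open>w\<close> woken before round \<open>t\<close>, its wake-up beep
        would already have woken \<open>u\<close>; so \<open>w\<close> wakes now and is
        beeping.\<close>
      have "wake_time w = t" if w: "(u, w) \<in> E" "w \<in> awake t" for w
      proof (rule ccontr)
        assume "wake_time w \<noteq> t"
        then have "Suc (wake_time w) \<le> t" "w \<in> woken" using w(2) by (auto simp: awake_iff)
        then have "u \<in> awake t"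
          using neighbor_woken[of w u] network_facts(3)[OF w(1)] by (auto simp: awake_iff)
        then show False using False by simp
      qed
      then show ?thesis unfolding nb by (auto simp: local_state_beeps)
    qed
    moreover have "run_of \<omega> (Suc t) u = (if u \<in> V \<and> (u \<in> W (Suc t) \<or> neighbor_beeps (algorithm3 c) E (run_of \<omega> t) u)
        then Some alg3_initial else None)"
      using False Suc.IH[of u] by (simp add: run_of_def Let_def)
    moreover have "wake_time u = Suc t" if "u \<in> awake (Suc t)"
      using that False unfolding awake_iff by auto
    ultimately show ?thesis using False by (auto simp: local_state_simps)
  qed
qed

lemma wakes_at_iff: "wakes_at (run_of \<omega>) u s \<longleftrightarrow> u \<in> woken \<and> s = wake_time u"
  by (auto simp: wakes_at_def run_of_eq awake_iff)

lemma ever_awake_eq: "ever_awake V (run_of \<omega>) = woken"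
  using woken_subset by (auto simp: ever_awake_def run_of_eq awake_iff)

text \<open>Within an exchange \<open>v\<close> can only be lost, so its value in each round is
  squeezed between those at the two ends of the exchange. The bound counts two initial rounds and
  three per exchange.\<close>

lemma mis_state_after:
  assumes "u \<in> woken" "wake_time u + (3 * offset J + 2) \<le> t"
  shows "(\<And>j k. J \<le> j \<Longrightarrow> fst (exchanges (flags_at (history \<omega>) j) (history \<omega> j) k u)) \<Longrightarrow>
      mis_state (algorithm3 c) (run_of \<omega> t) u"
    and "(\<And>j k. J \<le> j \<Longrightarrow> \<not> fst (exchanges (flags_at (history \<omega>) j) (history \<omega> j) k u)) \<Longrightarrow>
      \<not> mis_state (algorithm3 c) (run_of \<omega> t) u"
proof -
  define l where "l = t - wake_time u"
  have l: "3 * offset J + 2 \<le> l" "u \<in> awake t"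
    using assms by (auto simp: l_def awake_iff)
  then have mis: "mis_state (algorithm3 c) (run_of \<omega> t) u \<longleftrightarrow> v_flag (local_state \<omega> u l)"
    by (simp add: mis_state_def run_of_eq l_def)
  define q where "q = (l - 2) div 3"
  have q: "l = 3 * q + 2 \<or> l = 3 * q + 3 \<or> l = 3 * q + 4" "offset J \<le> q"
    using l(1) unfolding q_def by presburger+
  obtain j k where jk: "clock q = (j, k)" by fastforce
  have e0: "entry \<omega> q u = exchanges (flags_at (history \<omega>) j) (history \<omega> j) k u"
    by (simp add: entry_def jk)
  have e3: "fst (entry3 \<omega> q u)" if "fst (exchanges (flags_at (history \<omega>) j) (history \<omega> j) (Suc k) u)"
    using that unfolding exchanges_Suc_entry3[OF jk] by (auto simp: heed_def split: if_splits)
  have e32: "fst (entry3 \<omega> q u) \<Longrightarrow> fst (entry2 \<omega> q u)" "fst (entry2 \<omega> q u) \<Longrightarrow> fst (entry \<omega> q u)"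
    by (auto simp: entry3_def entry2_def heed_def split: if_splits)
  have "\<exists>f\<in>{entry \<omega> q u, entry2 \<omega> q u, entry3 \<omega> q u}. v_flag (local_state \<omega> u l) \<longleftrightarrow> fst f"
    using q(1) by (elim disjE) (simp_all add: local_state_simps node_at_simps)
  then obtain f where f: "mis_state (algorithm3 c) (run_of \<omega> t) u \<longleftrightarrow> fst f"
      "f \<in> {entry \<omega> q u, entry2 \<omega> q u, entry3 \<omega> q u}"
    unfolding mis by blast
  note after = clock_after[OF q(2) jk]
  show "mis_state (algorithm3 c) (run_of \<omega> t) u"
    if "\<And>j k. J \<le> j \<Longrightarrow> fst (exchanges (flags_at (history \<omega>) j) (history \<omega> j) k u)"
    using that[OF after, of "Suc k"] f e3 e32 by auto
  show "\<not> mis_state (algorithm3 c) (run_of \<omega> t) u"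
    if "\<And>j k. J \<le> j \<Longrightarrow> \<not> fst (exchanges (flags_at (history \<omega>) j) (history \<omega> j) k u)"
    using that[OF after, of k] f e0 e32 by auto
qed

section \<open>Deterministic consequences of resolution\<close>

context
  fixes \<omega> :: "'v \<Rightarrow> tape" and J T :: nat
  assumes proper: "\<And>j. proper (steplen j) (history \<omega> j)"
    and resolved: "resolved (flags_at (history \<omega>) J)"
    and T: "3 * offset J + 2 \<le> T"
begin

lemma locked_from:
  assumes "locked (flags_at (history \<omega>) J) u" "J \<le> j"
  shows "locked (flags_at (history \<omega>) j) u"
  using assms(2)
proof (induction rule: dec_induct)
  case (step j)
  from locked_persists[OF step.IH proper] show ?case by (simp add: run_def)
qed (rule assms(1))

lemma locked_decides_mis:
  assumes u: "u \<in> woken" and locked: "locked (flags_at (history \<omega>) J) u"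
  shows "decides_mis (algorithm3 c) (run_of \<omega>) T u"
proof -
  have "mis_state (algorithm3 c) (run_of \<omega> t) u" if "wake_time u + T \<le> t" for t
  proof -
    have "wake_time u + (3 * offset J + 2) \<le> t" using that T by simp
    then show ?thesis
      by (rule mis_state_after(1)[OF u]) (rule locked_exchanges(1)[OF locked_from[OF locked]])
  qed
  then show ?thesis using u by (auto simp: decides_mis_def wakes_at_iff)
qed

lemma dominated_decides_inactive:
  assumes u: "u \<in> woken" and locked: "locked (flags_at (history \<omega>) J) w" "(u, w) \<in> active_edges"
  shows "decides_inactive (algorithm3 c) (run_of \<omega>) T u" "\<not> decides_mis (algorithm3 c) (run_of \<omega>) T u"
proof -
  have never: "\<not> mis_state (algorithm3 c) (run_of \<omega> t) u" if "wake_time u + T \<le> t" for t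
  proof -
    have "wake_time u + (3 * offset J + 2) \<le> t" using that T by simp
    then show ?thesis
      by (rule mis_state_after(2)[OF u])
        (rule locked_exchanges(2)[OF locked_from[OF locked(1)] edge_sym[OF locked(2)]])
  qed
  then show "decides_inactive (algorithm3 c) (run_of \<omega>) T u"
    using u by (auto simp: decides_inactive_def wakes_at_iff)
  show "\<not> decides_mis (algorithm3 c) (run_of \<omega>) T u"
    using never[of "wake_time u + T"] by (auto simp: decides_mis_def wakes_at_iff)
qed

lemma resolved_cases:
  assumes "u \<in> woken"
  obtains "locked (flags_at (history \<omega>) J) u" |
    w where "(u, w) \<in> active_edges" "locked (flags_at (history \<omega>) J) w"
  using resolved assms unfolding resolved_def by blast

lemma resolved_decides:
  assumes "u \<in> woken"
  shows "decides_mis (algorithm3 c) (run_of \<omega>) T u \<or> decides_inactive (algorithm3 c) (run_of \<omega>) T u"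
  using assms
proof (cases rule: resolved_cases)
  case 1
  from locked_decides_mis[OF assms this] show ?thesis ..
next
  case (2 w)
  from dominated_decides_inactive(1)[OF assms 2(2,1)] show ?thesis ..
qed

lemma decides_mis_iff:
  "decides_mis (algorithm3 c) (run_of \<omega>) T u \<longleftrightarrow> u \<in> woken \<and> locked (flags_at (history \<omega>) J) u"
proof
  assume d: "decides_mis (algorithm3 c) (run_of \<omega>) T u"
  then have u: "u \<in> woken" by (auto simp: decides_mis_def wakes_at_iff)
  then show "u \<in> woken \<and> locked (flags_at (history \<omega>) J) u"
  proof (cases rule: resolved_cases)
    case (2 w)
    from dominated_decides_inactive(2)[OF u 2(2,1)] d show ?thesis by simp
  qed (use u in simp)
qed (use locked_decides_mis in blast)

lemma resolved_maximal_independent: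
  "maximal_independent_set woken E {u \<in> V. decides_mis (algorithm3 c) (run_of \<omega>) T u}"
proof -
  define S where "S = {u \<in> V. decides_mis (algorithm3 c) (run_of \<omega>) T u}"
  have S: "S = {u \<in> woken. locked (flags_at (history \<omega>) J) u}"
    using woken_subset unfolding S_def decides_mis_iff by blast
  have "independent_set woken E S"
    unfolding independent_set_def
  proof (intro conjI ballI)
    show "S \<subseteq> woken" by (auto simp: S)
    fix u w assume "u \<in> S" "w \<in> S"
    then have "u \<in> woken" "(u, w) \<notin> active_edges" by (auto simp: S locked_def)
    then show "(u, w) \<notin> E" by (simp add: active_edges_iff)
  qed
  moreover have "S' = S" if S': "independent_set woken E S'" "S \<subseteq> S'" for S'
  proof (rule ccontr)
    assume "S' \<noteq> S"
    then obtain u where u: "u \<in> S'" "u \<notin> S" using S'(2) by auto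
    then have uw: "u \<in> woken" using S'(1) by (auto simp: independent_set_def)
    then obtain w where "(u, w) \<in> active_edges" "locked (flags_at (history \<omega>) J) w"
      by (cases rule: resolved_cases) (use u(2) uw in \<open>auto simp: S\<close>)
    then have "(u, w) \<in> E" "w \<in> S'" using S'(2) by (auto simp: S active_edges_def)
    then show False using S'(1) u(1) by (auto simp: independent_set_def)
  qed
  ultimately show ?thesis by (auto simp: maximal_independent_set_def S_def)
qed

end

section \<open>Measurability and the law of the coins\<close>

definition coin_space :: "('v \<Rightarrow> tape) measure" where
  "coin_space = tapes (algorithm3 c) V"

abbreviation choice :: "nat \<times> nat \<Rightarrow> (bool \<times> bool list) pmf" where
  "choice m \<equiv> step_choice c (fst m) (snd m)"

lemma tape_distribution_eq: "tape_distribution c = (\<Pi>\<^sub>M m\<in>UNIV. measure_pmf (choice m))"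
  by (simp add: tape_distribution_def case_prod_unfold)

lemma coin_space_eq: "coin_space = (\<Pi>\<^sub>M u\<in>V. tape_distribution c)"
  by (simp add: coin_space_def tapes_def)

lemma prob_space_tape: "prob_space (tape_distribution c)"
  unfolding tape_distribution_eq by (intro prob_space_PiM measure_pmf.prob_space_axioms)

sublocale coins: prob_space coin_space
  unfolding coin_space_eq by (intro prob_space_PiM prob_space_tape)

lemma coin_measurable:
  assumes "u \<in> V"
  shows "(\<lambda>\<omega>. \<omega> u m) \<in> measurable coin_space (count_space UNIV)"
proof -
  have "(\<lambda>r. r m) \<in> measurable (tape_distribution c) (measure_pmf (choice m))"
    unfolding tape_distribution_eq by (rule measurable_component_singleton) simp
  then have "(\<lambda>r. r m) \<in> measurable (tape_distribution c) (count_space UNIV)"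
    by (simp cong: measurable_cong_sets)
  moreover have "(\<lambda>\<omega>. \<omega> u) \<in> measurable coin_space (tape_distribution c)"
    unfolding coin_space_eq by (rule measurable_component_singleton) (rule assms)
  ultimately show ?thesis by (rule measurable_compose[rotated])
qed

text \<open>Points of the product space are \<open>undefined\<close> outside \<open>V\<close>, so
  agreement on \<open>V\<close> is agreement everywhere.\<close>

lemma history_eqI:
  assumes "\<omega> \<in> space coin_space" "\<omega>' \<in> space coin_space"
    and "\<And>u. u \<in> V \<Longrightarrow> \<omega> u (step_index j) = \<omega>' u (step_index j)"
  shows "history \<omega> j = history \<omega>' j"
proof
  fix u
  show "history \<omega> j u = history \<omega>' j u"
  proof (cases "u \<in> V")
    case False
    then have "\<omega> u = undefined" "\<omega>' u = undefined"
      using assms(1,2) unfolding coin_space_eq space_PiM by (auto intro: PiE_arb)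
    then show ?thesis by (simp add: history_def)
  qed (simp add: history_def assms(3))
qed

text \<open>Only finitely many tape cells matter and their values form a countable type, so the
  event is a countable union of fibres, each given by finitely many measurable conditions.\<close>

lemma measurable_finite_dependence:
  assumes "\<And>\<omega> \<omega>'. \<omega> \<in> space coin_space \<Longrightarrow> \<omega>' \<in> space coin_space \<Longrightarrow>
    (\<And>j. j < N \<Longrightarrow> history \<omega> j = history \<omega>' j) \<Longrightarrow> P \<omega> = P \<omega>'"
  shows "Measurable.pred coin_space P"
proof -
  let ?I = "V \<times> {..<N}"
  let ?f = "\<lambda>\<omega>. restrict (\<lambda>(u, j). \<omega> u (step_index j)) ?I :: 'v \<times> nat \<Rightarrow> bool \<times> bool list"
  define S where "S = {\<omega> \<in> space coin_space. P \<omega>}"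
  have fin: "finite ?I" using network_facts(1) by simp
  have restricted: "restrict g ?I \<in> PiE ?I (\<lambda>_. UNIV)" for g :: "'v \<times> nat \<Rightarrow> bool \<times> bool list"
    unfolding restrict_PiE_iff by simp
  have fiber: "{\<omega> \<in> space coin_space. ?f \<omega> = a} \<in> sets coin_space" if "a \<in> PiE ?I (\<lambda>_. UNIV)" for a
  proof -
    have "{\<omega> \<in> space coin_space. ?f \<omega> = a} = {\<omega> \<in> space coin_space. \<forall>(u, j)\<in>?I. \<omega> u (step_index j) = a (u, j)}"
      using that by (auto simp: fun_eq_iff restrict_def PiE_def extensional_def split: if_splits)
    also have "\<dots> \<in> sets coin_space"
    proof (rule sets.sets_Collect_finite_All[OF _ fin])
      fix i assume "i \<in> ?I"
      then obtain u j where i: "i = (u, j)" "u \<in> V" by auto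
      have "{\<omega> \<in> space coin_space. \<omega> u (step_index j) = a (u, j)} =
          (\<lambda>\<omega>. \<omega> u (step_index j)) -` {a (u, j)} \<inter> space coin_space" by auto
      also have "\<dots> \<in> sets coin_space"
        by (rule measurable_sets[OF coin_measurable[OF i(2)]]) simp
      finally show "{\<omega> \<in> space coin_space. case i of (u, j) \<Rightarrow> \<omega> u (step_index j) = a (u, j)} \<in> sets coin_space"
        by (simp add: i)
    qed
    finally show ?thesis .
  qed
  have same: "P \<omega> = P \<omega>'" if "\<omega> \<in> space coin_space" "\<omega>' \<in> space coin_space" "?f \<omega> = ?f \<omega>'" for \<omega> \<omega>'
  proof (rule assms[OF that(1,2)], rule history_eqI[OF that(1,2)])
    fix j u assume "j < N" "u \<in> V"
    then show "\<omega> u (step_index j) = \<omega>' u (step_index j)"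
      using fun_cong[OF that(3), of "(u, j)"] by simp
  qed
  have "S = (\<Union>a\<in>?f ` S. {\<omega> \<in> space coin_space. ?f \<omega> = a})"
  proof
    show "S \<subseteq> (\<Union>a\<in>?f ` S. {\<omega> \<in> space coin_space. ?f \<omega> = a})" by (auto simp: S_def)
    show "(\<Union>a\<in>?f ` S. {\<omega> \<in> space coin_space. ?f \<omega> = a}) \<subseteq> S"
    proof
      fix \<omega> assume "\<omega> \<in> (\<Union>a\<in>?f ` S. {\<omega> \<in> space coin_space. ?f \<omega> = a})"
      then obtain \<omega>' where "\<omega>' \<in> S" "\<omega> \<in> space coin_space" "?f \<omega> = ?f \<omega>'" by blast
      then show "\<omega> \<in> S" using same[of \<omega> \<omega>'] unfolding S_def by blast
    qed
  qed
  also have "\<dots> \<in> sets coin_space"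
  proof (rule sets.countable_UN'')
    have "countable (PiE ?I (\<lambda>_. UNIV :: (bool \<times> bool list) set))"
      by (rule countable_PiE[OF fin]) simp
    moreover have "?f ` S \<subseteq> PiE ?I (\<lambda>_. UNIV)" using restricted by blast
    ultimately show "countable (?f ` S)" by (rule countable_subset[rotated])
    show "{\<omega> \<in> space coin_space. ?f \<omega> = a} \<in> sets coin_space" if "a \<in> ?f ` S" for a
      using that restricted by (intro fiber) blast
  qed
  finally show ?thesis by (simp add: pred_def S_def)
qed

lemma entries_cong:
  assumes "clock q = (j, k)" "\<And>i. i < Suc j \<Longrightarrow> history \<omega> i = history \<omega>' i"
  shows "entry \<omega> q = entry \<omega>' q" "entry2 \<omega> q = entry2 \<omega>' q" "entry3 \<omega> q = entry3 \<omega>' q"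
proof -
  have "flags_at (history \<omega>) j = flags_at (history \<omega>') j"
    by (rule flags_at_cong) (use assms(2) in simp)
  then show e: "entry \<omega> q = entry \<omega>' q"
    using assms(2)[of j] by (simp add: entry_def assms(1))
  have c: "contender \<omega> q = contender \<omega>' q"
    using assms(2)[of j] by (simp add: contender_def assms(1) e)
  show e2: "entry2 \<omega> q = entry2 \<omega>' q"
    by (rule ext) (simp only: entry2_def e c)
  show "entry3 \<omega> q = entry3 \<omega>' q"
    by (rule ext) (simp only: entry3_def e2 c)
qed

lemma v_flag_measurable: "Measurable.pred coin_space (\<lambda>\<omega>. v_flag (local_state \<omega> u l))"
proof -
  obtain j k where jk: "clock ((l - 2) div 3) = (j, k)" by fastforce
  show ?thesis
  proof (rule measurable_finite_dependence[of "Suc j"])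
    fix \<omega> \<omega>' assume "\<And>i. i < Suc j \<Longrightarrow> history \<omega> i = history \<omega>' i"
    note eqs = entries_cong[OF jk this]
    show "v_flag (local_state \<omega> u l) = v_flag (local_state \<omega>' u l)"
      by (auto simp: local_state_def Let_def node_at_simps eqs)
  qed
qed

lemma mis_state_iff:
  "mis_state (algorithm3 c) (run_of \<omega> t) u \<longleftrightarrow> u \<in> awake t \<and> v_flag (local_state \<omega> u (t - wake_time u))"
  by (simp add: mis_state_def run_of_eq)

lemma mis_state_measurable [measurable]:
  "Measurable.pred coin_space (\<lambda>\<omega>. mis_state (algorithm3 c) (run_of \<omega> t) u)"
  unfolding mis_state_iff using v_flag_measurable by measurable

lemma decides_measurable [measurable]:
  "Measurable.pred coin_space (\<lambda>\<omega>. decides_mis (algorithm3 c) (run_of \<omega>) T u)"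
  "Measurable.pred coin_space (\<lambda>\<omega>. decides_inactive (algorithm3 c) (run_of \<omega>) T u)"
  unfolding decides_mis_def decides_inactive_def wakes_at_iff by measurable

text \<open>Since \<open>V\<close> is finite, the event is a finite disjunction over the possible
  sets \<open>S\<close> of conditions on single nodes.\<close>

lemma maximal_independent_measurable:
  "Measurable.pred coin_space
    (\<lambda>\<omega>. maximal_independent_set woken E {u \<in> V. decides_mis (algorithm3 c) (run_of \<omega>) T u})"
proof -
  have "maximal_independent_set woken E {u \<in> V. decides_mis (algorithm3 c) (run_of \<omega>) T u} \<longleftrightarrow>
      (\<exists>S\<in>Pow V. maximal_independent_set woken E S \<and>
        (\<forall>u\<in>V. decides_mis (algorithm3 c) (run_of \<omega>) T u \<longleftrightarrow> u \<in> S))" (is "?L \<longleftrightarrow> ?R") for \<omega>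
  proof
    assume ?L
    then show ?R by (intro bexI[of _ "{u \<in> V. decides_mis (algorithm3 c) (run_of \<omega>) T u}"]) auto
  next
    assume ?R
    then obtain S where S: "S \<subseteq> V" "maximal_independent_set woken E S"
      "\<forall>u\<in>V. decides_mis (algorithm3 c) (run_of \<omega>) T u \<longleftrightarrow> u \<in> S" by auto
    then have "{u \<in> V. decides_mis (algorithm3 c) (run_of \<omega>) T u} = S" by auto
    then show ?L using S by simp
  qed
  moreover have "finite (Pow V)" "finite V" using network_facts by auto
  ultimately show ?thesis by simp
qed

text \<open>The product space contains tapes off the support of the choices; these are excluded by
  countably many null sets, for all steps simultaneously.\<close>

lemma AE_proper: "AE \<omega> in coin_space. \<forall>j. proper (steplen j) (history \<omega> j)"
proof -
  have tape: "AE r in tape_distribution c. r m \<in> set_pmf (choice m)" for m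
    unfolding tape_distribution_eq
    by (rule AE_PiM_component[where P = "\<lambda>y. y \<in> set_pmf (choice m)"])
      (auto intro: measure_pmf.prob_space_axioms simp: AE_measure_pmf_iff)
  have "AE \<omega> in coin_space. \<omega> u m \<in> set_pmf (choice m)" if "u \<in> V" for u m
    unfolding coin_space_eq
    by (rule AE_PiM_component[where P = "\<lambda>r. r m \<in> set_pmf (choice m)"]) (use prob_space_tape that tape in auto)
  then have "AE \<omega> in coin_space. \<forall>u\<in>V. \<forall>j. \<omega> u (step_index j) \<in> set_pmf (choice (step_index j))"
    using network_facts(1) by (simp add: AE_finite_all AE_all_countable)
  then show ?thesis
  proof eventually_elim
    case (elim \<omega>)
    show ?case
      unfolding proper_def
    proof (intro allI ballI)
      fix j u assume "u \<in> woken"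
      then have "history \<omega> j u \<in> set_pmf (choice (step_index j))"
        using elim woken_subset by (auto simp: history_def)
      then show "length (snd (history \<omega> j u)) = steplen j \<and> (\<exists>k<steplen j. snd (history \<omega> j u) ! k)"
        using subsetD[OF set_step_choice[of c "fst (step_index j)" "snd (step_index j)"], of "history \<omega> j u"]
          steplen_pos[of j]
        unfolding steplen_def case_prod_unfold by blast
    qed
  qed
qed

section \<open>Transfer from finite histories to infinite tapes\<close>

definition cylinder :: "nat \<Rightarrow> (nat \<Rightarrow> 'v choices) \<Rightarrow> ('v \<Rightarrow> tape) set" where
  "cylinder N a = {\<omega> \<in> space coin_space. \<forall>u\<in>woken. \<forall>j<N. \<omega> u (step_index j) = a j u}"

lemma
  assumes "a \<in> set_pmf (histories N)"
  shows sets_cylinder: "cylinder N a \<in> sets coin_space"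
    and prob_cylinder: "measure coin_space (cylinder N a) = pmf (histories N) a"
proof -
  let ?J = "step_index ` {..<N}"
  let ?k = "inv step_index"
  define B where "B u = prod_emb UNIV (\<lambda>m. measure_pmf (choice m)) ?J (PiE ?J (\<lambda>m. {a (?k m) u}))" for u
  have k: "?k (step_index j) = j" for j by (rule inv_f_f[OF inj_step_index])
  have B_iff: "r \<in> B u \<longleftrightarrow> (\<forall>j<N. r (step_index j) = a j u)" for r u
    by (auto simp: B_def prod_emb_def PiE_iff k)
  have setsB: "B u \<in> sets (tape_distribution c)" for u
    unfolding tape_distribution_eq B_def by (rule sets_PiM_I) auto
  have finw: "finite woken" using woken_subset network_facts(1) finite_subset by blast
  have cyl: "cylinder N a = prod_emb V (\<lambda>_. tape_distribution c) woken (PiE woken B)"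
    using woken_subset
    by (auto simp: cylinder_def prod_emb_def coin_space_eq space_PiM B_iff PiE_iff intro: extensional_arb)
  show "cylinder N a \<in> sets coin_space"
    unfolding cyl coin_space_eq by (rule sets_PiM_I) (use woken_subset finw setsB in auto)
  have "emeasure (tape_distribution c) (B u) = (\<Prod>m\<in>?J. emeasure (measure_pmf (choice m)) {a (?k m) u})" for u
    unfolding tape_distribution_eq B_def
    by (rule emeasure_PiM_emb) (auto intro: measure_pmf.prob_space_axioms)
  also have "\<dots> u = (\<Prod>j<N. ennreal (pmf (choice (step_index j)) (a j u)))" for u
    by (subst prod.reindex) (use inj_step_index in \<open>auto simp: emeasure_pmf_single k intro: inj_on_subset\<close>)
  finally have "emeasure (tape_distribution c) (B u) = (\<Prod>j<N. ennreal (pmf (choice (step_index j)) (a j u)))" for u .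
  then have "emeasure coin_space (cylinder N a) = (\<Prod>u\<in>woken. \<Prod>j<N. ennreal (pmf (choice (step_index j)) (a j u)))"
    unfolding cyl coin_space_eq
    by (subst emeasure_PiM_emb) (use prob_space_tape woken_subset finw setsB in auto)
  also have "\<dots> = ennreal (\<Prod>u\<in>woken. \<Prod>j<N. pmf (choice (step_index j)) (a j u))"
    by (simp add: prod_ennreal prod_nonneg)
  finally have "measure coin_space (cylinder N a) = (\<Prod>u\<in>woken. \<Prod>j<N. pmf (choice (step_index j)) (a j u))"
    by (simp add: measure_def prod_nonneg)
  also have "\<dots> = (\<Prod>j<N. \<Prod>u\<in>woken. pmf (choice (step_index j)) (a j u))"
    by (rule prod.swap)
  also have "\<dots> = (\<Prod>j<N. pmf (step_choices j) (a j))"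
  proof (rule prod.cong[OF refl])
    fix j assume "j \<in> {..<N}"
    then have "a j \<in> set_pmf (step_choices j)"
      using assms by (auto simp: histories_def set_Pi_pmf PiE_dflt_def)
    \<comment> \<open>The product formula for \<open>pmf (step_choices j)\<close> presupposes
      default values outside \<open>woken\<close>; membership in the support provides them.\<close>
    then have "\<And>u. u \<notin> woken \<Longrightarrow> a j u = (False, [])"
      by (auto simp: step_choices_def set_Pi_pmf[OF finw] PiE_dflt_def)
    then show "(\<Prod>u\<in>woken. pmf (choice (step_index j)) (a j u)) = pmf (step_choices j) (a j)"
      unfolding step_choices_def by (subst pmf_Pi'[OF finw]) auto
  qed
  also have "\<dots> = pmf (histories N) a"
    unfolding histories_def
    by (subst pmf_Pi') (use assms in \<open>auto simp: histories_def set_Pi_pmf PiE_dflt_def\<close>)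
  finally show "measure coin_space (cylinder N a) = pmf (histories N) a" .
qed

text \<open>The histories in the support are finitely many and have disjoint cylinders, so the
  probability of \<open>Q\<close> is the measure of a union of cylinders on which \<open>P\<close>
  holds.\<close>

lemma histories_le_coin_space:
  assumes meas: "Measurable.pred coin_space P"
    and dep: "\<And>\<omega> a. \<omega> \<in> cylinder N a \<Longrightarrow> Q a \<Longrightarrow> P \<omega>"
  shows "measure_pmf.prob (histories N) {a. Q a} \<le> measure coin_space {\<omega> \<in> space coin_space. P \<omega>}"
proof -
  let ?S = "{a. Q a} \<inter> set_pmf (histories N)"
  have fin: "finite ?S" using finite_set_histories by simp
  have disj: "cylinder N a \<inter> cylinder N b = {}" if "a \<in> ?S" "b \<in> ?S" "a \<noteq> b" for a b
  proof -
    \<comment> \<open>Elsewhere both histories take the default values, so agreement on the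
      constrained cells is equality.\<close>
    have ext: "b = a" if ab: "\<forall>u\<in>woken. \<forall>j<N. a j u = b j u"
    proof (rule ext, rule ext)
      fix j u
      have a: "a \<in> set_pmf (histories N)" and b: "b \<in> set_pmf (histories N)"
        using \<open>a \<in> ?S\<close> \<open>b \<in> ?S\<close> by auto
      have out: "h j u = (False, [])" if "h \<in> set_pmf (histories N)" "\<not> (j < N \<and> u \<in> woken)" for h
        using that finite_U
        by (cases "j < N") (auto simp: histories_def set_Pi_pmf PiE_dflt_def step_choices_def)
      show "b j u = a j u" using ab out[OF a] out[OF b] by (cases "j < N \<and> u \<in> woken") auto
    qed
    show ?thesis
    proof (rule ccontr)
      assume "cylinder N a \<inter> cylinder N b \<noteq> {}"
      then have "\<forall>u\<in>woken. \<forall>j<N. a j u = b j u" by (auto simp: cylinder_def)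
      then show False using ext that(3) by simp
    qed
  qed
  have "measure_pmf.prob (histories N) {a. Q a} = measure_pmf.prob (histories N) ?S"
    by (simp add: measure_Int_set_pmf)
  also have "\<dots> = (\<Sum>a\<in>?S. pmf (histories N) a)"
    by (rule measure_measure_pmf_finite[OF fin])
  also have "\<dots> = (\<Sum>a\<in>?S. measure coin_space (cylinder N a))"
    by (rule sum.cong) (auto simp: prob_cylinder)
  also have "\<dots> = measure coin_space (\<Union>a\<in>?S. cylinder N a)"
    by (rule coins.finite_measure_finite_Union[symmetric])
      (use fin sets_cylinder disj in \<open>auto simp: disjoint_family_on_def\<close>)
  also have "\<dots> \<le> measure coin_space {\<omega> \<in> space coin_space. P \<omega>}"
  proof (rule coins.finite_measure_mono)
    show "(\<Union>a\<in>?S. cylinder N a) \<subseteq> {\<omega> \<in> space coin_space. P \<omega>}"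
      using dep by (auto simp: cylinder_def)
    show "{\<omega> \<in> space coin_space. P \<omega>} \<in> sets coin_space"
      using meas by (simp add: pred_def)
  qed
  finally show ?thesis .
qed

section \<open>The success probability\<close>

lemma resolved_measurable: "Measurable.pred coin_space (\<lambda>\<omega>. resolved (flags_at (history \<omega>) J))"
proof (rule measurable_finite_dependence[of J])
  fix \<omega> \<omega>' assume "\<And>i. i < J \<Longrightarrow> history \<omega> i = history \<omega>' i"
  then have "flags_at (history \<omega>) J = flags_at (history \<omega>') J" by (rule flags_at_cong)
  then show "resolved (flags_at (history \<omega>) J) = resolved (flags_at (history \<omega>') J)" by simp
qed

lemma prob_resolved:
  assumes x: "1 \<le> x" "card V \<le> 2 ^ x"
    and \<epsilon>: "(real (card V))\<^sup>2 * (4 / 2 ^ x + (1 - 1 / 4096) ^ m) \<le> \<epsilon>"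
    and J: "J = loop_start (x + m + 3)"
  shows "1 - \<epsilon> \<le> coins.prob {\<omega> \<in> space coin_space. resolved (flags_at (history \<omega>) J)}"
proof -
  have le: "card woken \<le> card V"
    by (rule card_mono[OF network_facts(1) woken_subset])
  have "measure_pmf.prob (histories J) {h. \<not> resolved (flags_at h J)} \<le>
      (real (card woken))\<^sup>2 * (4 / 2 ^ x + (1 - 1 / 4096) ^ m)"
    by (rule prob_unresolved) (use x le J in auto)
  also have "\<dots> \<le> (real (card V))\<^sup>2 * (4 / 2 ^ x + (1 - 1 / 4096) ^ m)"
    using le by (intro mult_right_mono power_mono) auto
  finally have "1 - \<epsilon> \<le> 1 - measure_pmf.prob (histories J) {h. \<not> resolved (flags_at h J)}"
    using \<epsilon> by simp
  also have "\<dots> = measure_pmf.prob (histories J) {h. resolved (flags_at h J)}"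
    using measure_pmf.prob_compl[of "{h. \<not> resolved (flags_at h J)}" "histories J"]
    by (simp add: Compl_eq_Diff_UNIV[symmetric] Collect_neg_eq[symmetric])
  also have "\<dots> \<le> coins.prob {\<omega> \<in> space coin_space. resolved (flags_at (history \<omega>) J)}"
  proof (rule histories_le_coin_space[OF resolved_measurable])
    fix \<omega> a assume "\<omega> \<in> cylinder J a" "resolved (flags_at a J)"
    moreover from this have "flags_at (history \<omega>) J u = flags_at a J u" if "u \<in> woken" for u
      by (intro flags_at_cong_on[of J]) (use that in \<open>auto simp: cylinder_def history_def\<close>)
    ultimately show "resolved (flags_at (history \<omega>) J)"
      using resolved_cong[of "flags_at (history \<omega>) J" "flags_at a J"] by simp
  qed
  finally show ?thesis .
qed

lemma prob_if_resolved:
  assumes "1 - \<epsilon> \<le> coins.prob {\<omega> \<in> space coin_space. resolved (flags_at (history \<omega>) J)}"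
    and meas: "Measurable.pred coin_space P"
    and imp: "\<And>\<omega>. (\<And>j. proper (steplen j) (history \<omega> j)) \<Longrightarrow> resolved (flags_at (history \<omega>) J) \<Longrightarrow> P \<omega>"
  shows "1 - \<epsilon> \<le> coins.prob {\<omega> \<in> space coin_space. P \<omega>}"
proof -
  have "coins.prob {\<omega> \<in> space coin_space. resolved (flags_at (history \<omega>) J)} \<le>
      coins.prob {\<omega> \<in> space coin_space. P \<omega>}"
  proof (rule coins.finite_measure_mono_AE)
    show "AE \<omega> in coin_space. \<omega> \<in> {\<omega> \<in> space coin_space. resolved (flags_at (history \<omega>) J)} \<longrightarrow>
        \<omega> \<in> {\<omega> \<in> space coin_space. P \<omega>}"
      using AE_proper by eventually_elim (use imp in blast)
    show "{\<omega> \<in> space coin_space. P \<omega>} \<in> sets coin_space"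
      using meas by (simp add: pred_def)
  qed
  then show ?thesis using assms(1) by linarith
qed

text \<open>The origin of the cubic bound: quadratically many steps precede loop
  \<open>y + 1\<close>, each of at most \<open>c * y\<close> exchanges.\<close>

lemma offset_le:
  assumes "J = loop_start (Suc y)"
  shows "offset J \<le> c * (y + 1) ^ 3"
proof -
  have "offset J \<le> (\<Sum>i<J. c * y)"
    unfolding offset_def steplen_def
    by (intro sum_mono mult_left_mono) (use assms in \<open>auto intro: step_index_le\<close>)
  also have "\<dots> = J * (c * y)" by simp
  also have "\<dots> \<le> (Suc y * Suc y) * (c * Suc y)"
    using loop_start_le[of "Suc y"] assms by (intro mult_mono) auto
  also have "\<dots> = c * (y + 1) ^ 3" by (simp add: power3_eq_cube algebra_simps)
  finally show ?thesis .
qed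

lemma locally_converges:
  assumes x: "1 \<le> x" "card V \<le> 2 ^ x"
    and \<epsilon>: "(real (card V))\<^sup>2 * (4 / 2 ^ x + (1 - 1 / 4096) ^ m) \<le> \<epsilon>"
    and T: "3 * (c * (x + m + 3) ^ 3) + 2 \<le> T"
  shows "u \<in> V \<Longrightarrow> 1 - \<epsilon> \<le> \<P>(\<omega> in tapes (algorithm3 c) V.
              let R = execution (algorithm3 c) V E W \<omega> in
              u \<in> ever_awake V R \<longrightarrow> decides_mis (algorithm3 c) R T u \<or> decides_inactive (algorithm3 c) R T u)"
    and "1 - \<epsilon> \<le> \<P>(\<omega> in tapes (algorithm3 c) V.
              let R = execution (algorithm3 c) V E W \<omega> in
              maximal_independent_set (ever_awake V R) E {u \<in> V. decides_mis (algorithm3 c) R T u})"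
proof -
  define J where "J = loop_start (x + m + 3)"
  have "offset J \<le> c * (x + m + 3) ^ 3"
    using offset_le[of J "x + m + 2"] by (simp add: J_def eval_nat_numeral)
  then have TJ: "3 * offset J + 2 \<le> T" using T by linarith
  note res = prob_resolved[OF x \<epsilon> J_def]
  show "1 - \<epsilon> \<le> \<P>(\<omega> in tapes (algorithm3 c) V.
              let R = execution (algorithm3 c) V E W \<omega> in
              u \<in> ever_awake V R \<longrightarrow> decides_mis (algorithm3 c) R T u \<or> decides_inactive (algorithm3 c) R T u)"
    unfolding run_of_def[symmetric] Let_def ever_awake_eq coin_space_def[symmetric]
  proof (rule prob_if_resolved[OF res])
    show "Measurable.pred coin_space (\<lambda>\<omega>. u \<in> woken \<longrightarrow>
        decides_mis (algorithm3 c) (run_of \<omega>) T u \<or> decides_inactive (algorithm3 c) (run_of \<omega>) T u)"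
      by measurable
  qed (use resolved_decides TJ in blast)
  show "1 - \<epsilon> \<le> \<P>(\<omega> in tapes (algorithm3 c) V.
              let R = execution (algorithm3 c) V E W \<omega> in
              maximal_independent_set (ever_awake V R) E {u \<in> V. decides_mis (algorithm3 c) R T u})"
    unfolding run_of_def[symmetric] Let_def ever_awake_eq coin_space_def[symmetric]
    by (rule prob_if_resolved[OF res maximal_independent_measurable])
      (use resolved_maximal_independent TJ in blast)
qed

end

section \<open>The running time\<close>

text \<open>The added 1 keeps the value positive for \<open>n \<le> 1\<close> too, as needed for
  \<open>1 \<le> x\<close> and for \<open>2 \<le> P\<close> in \<open>error_bound\<close>.\<close>

definition log_bound :: "nat \<Rightarrow> nat" where
  "log_bound n = nat \<lceil>log 2 (real n)\<rceil> + 1"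

lemma log_bound_ge: "n \<le> 2 ^ log_bound n"
proof (cases "n = 0")
  case False
  then have "real n = 2 powr (log 2 (real n))" by simp
  also have "\<dots> \<le> 2 powr (real (log_bound n))"
    unfolding log_bound_def by (intro powr_mono) linarith+
  also have "\<dots> = real (2 ^ log_bound n)" by (simp add: powr_realpow)
  finally show ?thesis by (simp only: of_nat_le_iff)
qed simp

lemma log_bound_bigo:
  "(\<lambda>n. real (3 * (c * (a * log_bound n + b * log_bound n + 3) ^ 3) + 2)) \<in> O(\<lambda>n. ln (real n) ^ 3)"
proof -
  define D where "D = 1 / ln 2 + (2::real)"
  define K where "K = (real a + real b) * D + 3"
  have "real (3 * (c * (a * log_bound n + b * log_bound n + 3) ^ 3) + 2) \<le>
      (3 * (real c * K ^ 3) + 2) * ln (real n) ^ 3" if n: "3 \<le> n" for n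
  proof -
    \<comment> \<open>From \<open>n = 3\<close> on, \<open>ln n\<close> is at least 1, which lets
      the additive constants be absorbed into \<open>D\<close> and \<open>K\<close>.\<close>
    have "exp 1 \<le> real n" using exp_le n by linarith
    then have ln1: "1 \<le> ln (real n)" using n by (subst ln_ge_iff) auto
    have "real (log_bound n) \<le> log 2 (real n) + 2"
      unfolding log_bound_def using n by (simp add: log_def) linarith
    also have "\<dots> = ln (real n) / ln 2 + 2" by (simp add: log_def)
    also have "\<dots> \<le> D * ln (real n)" using ln1 by (simp add: D_def algebra_simps)
    finally have "(real a + real b) * real (log_bound n) \<le> (real a + real b) * (D * ln (real n))"
      by (intro mult_left_mono) auto
    then have "real (a * log_bound n + b * log_bound n + 3) \<le> K * ln (real n)"
      using ln1 by (simp add: K_def algebra_simps)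
    then have "real (a * log_bound n + b * log_bound n + 3) ^ 3 \<le> (K * ln (real n)) ^ 3"
      by (rule power_mono) simp
    then have "real c * real (a * log_bound n + b * log_bound n + 3) ^ 3 \<le> real c * (K * ln (real n)) ^ 3"
      by (rule mult_left_mono) simp
    moreover have "1 \<le> ln (real n) ^ 3" using ln1 by (rule one_le_power)
    moreover have "real (3 * (c * (a * log_bound n + b * log_bound n + 3) ^ 3) + 2) =
        3 * (real c * real (a * log_bound n + b * log_bound n + 3) ^ 3) + 2"
      by (simp only: of_nat_add of_nat_mult of_nat_power of_nat_numeral)
    ultimately show ?thesis
      by (simp add: power_mult_distrib algebra_simps)
  qed
  then show ?thesis
    by (intro bigoI[of _ "3 * (real c * K ^ 3) + 2"] eventually_at_top_linorderI[of 3]) (auto simp del: of_nat_add)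
qed

text \<open>With \<open>P = 2 ^ log_bound n \<ge> n\<close>, the 5 in \<open>a\<close> pays
  \<open>P ^ 2\<close> for the factor \<open>n ^ 2\<close> and \<open>P ^ 3 \<ge> 5\<close> for the
  numerators 4 and 1; the exponent \<open>c'\<close> is what remains.\<close>

lemma error_bound:
  fixes c' :: real
  assumes c': "1 \<le> c'" and a: "a = nat \<lceil>c'\<rceil> + 5" and b: "(1 - 1 / 4096 :: real) ^ b \<le> 1 / 2 ^ a"
  shows "(real n)\<^sup>2 * (4 / 2 ^ (a * log_bound n) + (1 - 1 / 4096) ^ (b * log_bound n)) \<le> real n powr (- c')"
proof (cases "n = 0")
  case False
  define P :: real where "P = 2 ^ log_bound n"
  have P2: "2 \<le> P" unfolding P_def log_bound_def using one_le_power[of "2::real"] by simp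
  have nP: "real n \<le> P"
    using log_bound_ge[of n] unfolding P_def by (metis of_nat_le_iff of_nat_numeral of_nat_power)
  have "(1 - 1 / 4096 :: real) ^ (b * log_bound n) \<le> (1 / 2 ^ a) ^ log_bound n"
    unfolding power_mult by (intro power_mono b) auto
  also have "\<dots> = 1 / P ^ a"
    by (simp add: P_def power_one_over power_mult[symmetric] mult.commute)
  finally have "4 / 2 ^ (a * log_bound n) + (1 - 1 / 4096) ^ (b * log_bound n) \<le> 5 / P ^ a"
    by (simp add: P_def power_mult[symmetric] mult.commute)
  then have "(real n)\<^sup>2 * (4 / 2 ^ (a * log_bound n) + (1 - 1 / 4096) ^ (b * log_bound n)) \<le> P\<^sup>2 * (5 / P ^ a)"
    using nP P2 by (intro mult_mono power_mono) auto
  also have "\<dots> \<le> P\<^sup>2 * (P ^ 3 / P ^ a)"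
  proof (intro mult_left_mono divide_right_mono)
    have "(2::real) ^ 3 \<le> P ^ 3" using P2 by (intro power_mono) auto
    then show "5 \<le> P ^ 3" by simp
  qed (use P2 in auto)
  also have "\<dots> = P ^ 5 / P ^ a"
    by (simp add: eval_nat_numeral)
  also have "\<dots> = P powr (5 - real a)"
    unfolding powr_diff using P2 by (simp add: powr_realpow)
  also have "\<dots> \<le> P powr (- c')"
    using P2 a by (intro powr_mono) linarith+
  also have "\<dots> \<le> real n powr (- c')"
    using False nP c' by (intro powr_mono2') auto
  finally show ?thesis .
qed simp

theorem theorem4:
  shows "\<exists>c\<^sub>0::nat. \<forall>c\<ge>c\<^sub>0. \<forall>c'::real. c' \<ge> 1 \<longrightarrow>
           (\<exists>T::nat \<Rightarrow> nat. (\<lambda>n. real (T n)) \<in> O(\<lambda>n. ln (real n) ^ 3) \<and>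
              (\<forall>(V::'v set) E. network V E \<longrightarrow>
                 locally_converges_to_mis (algorithm3 c) c' V E (T (card V))))"
\<comment> \<open>The value 2 is what \<open>sum_collision_bounds\<close> requires;
  \<open>c'\<close> enters only through \<open>a\<close> and \<open>b\<close>, that is, through the
  number of loops.\<close>
proof (intro exI[of _ 2] allI impI)
  fix c :: nat and c' :: real
  assume c: "2 \<le> c" and c': "1 \<le> c'"
  define a where "a = nat \<lceil>c'\<rceil> + 5"
  \<comment> \<open>Contracting over \<open>b * log_bound n\<close> loops is thus at least as strong
    as the collision bound at loop \<open>a * log_bound n\<close>.\<close>
  obtain b where "(1 - 1 / 4096 :: real) ^ b < 1 / 2 ^ a"
    using real_arch_pow_inv[of "1 / 2 ^ a" "1 - 1 / 4096"] by auto
  then have b: "(1 - 1 / 4096 :: real) ^ b \<le> 1 / 2 ^ a" by simp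
  define T where "T n = 3 * (c * (a * log_bound n + b * log_bound n + 3) ^ 3) + 2" for n
  have "locally_converges_to_mis (algorithm3 c) c' V E (T (card V))" if "network V E" for V :: "'v set" and E
    unfolding locally_converges_to_mis_def
  proof (intro allI conjI ballI)
    fix W :: "nat \<Rightarrow> 'v set"
    let ?l = "log_bound (card V)"
    interpret wakeup_schedule V E W c
      using that c by unfold_locales
    have x: "1 \<le> a * ?l" by (simp add: a_def log_bound_def)
    have "(2::nat) ^ ?l \<le> 2 ^ (a * ?l)"
      by (rule power_increasing) (simp_all add: a_def)
    then have V: "card V \<le> 2 ^ (a * ?l)"
      using log_bound_ge[of "card V"] by (rule order_trans[rotated])
    note conv = locally_converges[OF x V error_bound[OF c' a_def b] eq_refl[OF T_def[symmetric]]]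
    show "u \<in> V \<Longrightarrow> 1 - real (card V) powr (- c') \<le> \<P>(\<omega> in tapes (algorithm3 c) V.
              let R = execution (algorithm3 c) V E W \<omega> in
              u \<in> ever_awake V R \<longrightarrow> decides_mis (algorithm3 c) R (T (card V)) u \<or>
                decides_inactive (algorithm3 c) R (T (card V)) u)" for u
      by (rule conv(1))
    show "1 - real (card V) powr (- c') \<le> \<P>(\<omega> in tapes (algorithm3 c) V.
              let R = execution (algorithm3 c) V E W \<omega> in
              maximal_independent_set (ever_awake V R) E
                {u \<in> V. decides_mis (algorithm3 c) R (T (card V)) u})"
      by (rule conv(2))
  qed
  moreover have "(\<lambda>n. real (T n)) \<in> O(\<lambda>n. ln (real n) ^ 3)"
    unfolding T_def by (rule log_bound_bigo)
  ultimately show "\<exists>T::nat \<Rightarrow> nat. (\<lambda>n. real (T n)) \<in> O(\<lambda>n. ln (real n) ^ 3) \<and>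
      (\<forall>(V::'v set) E. network V E \<longrightarrow> locally_converges_to_mis (algorithm3 c) c' V E (T (card V)))"
    by blast
qed

end
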